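(* Let $d\ge 2$ be an integer. There are infinitely many minimally non-$O(n^{d-1})$ $d$-dimensional 0-1 matrices with all dimensions of length greater than $1$.
   Context: A $d$-dimensional 0-1 matrix $A$ contains a $d$-dimensional 0-1 matrix $P$ if $A$ has a submatrix (obtained by restricting each of the $d$ coordinates to a subset of its range) of the same dimensions as $P$ that can be turned into $P$ by changing any number of $1$-entries to $0$-entries; otherwise $A$ avoids $P$ (is $P$-free). $P'$ is properly contained in $P$ if $P$ contains $P'$ and $P'\neq P$. $\operatorname{ex}(n,P,d)$ is the maximum possible number of $1$-entries in a $P$-free $d$-dimensional 0-1 matrix of dimensions $n\times n\times\dots\times n$ (taken to be $0$ if no such matrix exists). A $d$-dimensional 0-1 matrix $P$ is minimally non-$O(n^{d-1})$ if $\operatorname{ex}(n,P,d)=\omega(n^{d-1})$ but $\operatorname{ex}(n,P',d)=O(n^{d-1})$ for every $d$-dimensional 0-1 matrix $P'$ properly contained in $P$. Asymptotics are for $n\to\infty$ with the forbidden matrix and $d$ fixed. *)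

theory Defs
  imports Complex_Main "HOL-Library.Landau_Symbols"
begin

text \<open>A multidimensional 0-1 matrix is given by its list of side lengths together with the set
  of (0-based) positions of its 1-entries. On well-formed matrices this representation is
  canonical: equality of values is equality of matrices.\<close>

datatype matrix01 = Matrix01 (dims: "nat list") (ones: "nat list set")

definition positions :: "nat list \<Rightarrow> nat list set" where
  "positions ns = {x. list_all2 (<) x ns}"

definition is_matrix01 :: "nat \<Rightarrow> matrix01 \<Rightarrow> bool" where
  "is_matrix01 d A \<longleftrightarrow>
     length (dims A) = d \<and> (\<forall>k\<in>set (dims A). 0 < k) \<and> ones A \<subseteq> positions (dims A)"

text \<open>The \<open>i\<close>-th entry of \<open>S\<close> is the set of values retained in coordinate \<open>i\<close>; the retained values
  are renumbered in increasing order.\<close>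

definition submatrix01 :: "matrix01 \<Rightarrow> nat set list \<Rightarrow> matrix01" where
  "submatrix01 A S = Matrix01 (map card S)
     {x \<in> positions (map card S). map2 (\<lambda>T k. sorted_list_of_set T ! k) S x \<in> ones A}"

definition contains :: "matrix01 \<Rightarrow> matrix01 \<Rightarrow> bool" where
  "contains A P \<longleftrightarrow>
     (\<exists>S. list_all2 (\<lambda>T k. T \<subseteq> {..<k}) S (dims A) \<and>
          dims (submatrix01 A S) = dims P \<and> ones P \<subseteq> ones (submatrix01 A S))"

definition avoids :: "matrix01 \<Rightarrow> matrix01 \<Rightarrow> bool" where
  "avoids A P \<longleftrightarrow> \<not> contains A P"

definition properly_contained :: "matrix01 \<Rightarrow> matrix01 \<Rightarrow> bool" where
  "properly_contained P' P \<longleftrightarrow> contains P P' \<and> P' \<noteq> P"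

definition free_matrices :: "nat \<Rightarrow> matrix01 \<Rightarrow> nat \<Rightarrow> matrix01 set" where
  "free_matrices n P d = {A. is_matrix01 d A \<and> dims A = replicate d n \<and> avoids A P}"

definition ex :: "nat \<Rightarrow> matrix01 \<Rightarrow> nat \<Rightarrow> nat" where
  "ex n P d = (if free_matrices n P d = {} then 0
               else Max ((\<lambda>A. card (ones A)) ` free_matrices n P d))"

definition minimally_non_O :: "nat \<Rightarrow> matrix01 \<Rightarrow> bool" where
  "minimally_non_O d P \<longleftrightarrow>
     is_matrix01 d P \<and>
     (\<lambda>n. real (ex n P d)) \<in> \<omega>(\<lambda>n. real n ^ (d - 1)) \<and>
     (\<forall>P'. is_matrix01 d P' \<and> properly_contained P' P \<longrightarrow>
           (\<lambda>n. real (ex n P' d)) \<in> O(\<lambda>n. real n ^ (d - 1)))"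

end

theory Submission
  imports Defs
begin

text \<open>In dimension 2 consider the patterns \<open>horn k\<close>: a horizontal pair of ones at the upper left and a
  vertical pair at the lower right, linked by a chain of ones in different rows and columns. They are
  not contained in the hypercube matrices, which have \<open>n log n\<close> ones, so they are not linear. A
  pattern in which one of the pairs is broken is part of a double permutation matrix (or a transposed
  one) and hence linear, by a Marcus--Tardos argument for intervals. If a link on the diagonal is
  missing, the pattern is a direct sum of two such patterns, and again linear. So a minimal nonlinear
  part of \<open>horn k\<close> still contains both pairs and all \<open>k + 1\<close> links; it is not a direct sum, so its
  extremal function is superadditive and not only fails to be \<open>O(n)\<close> but is \<open>\<omega>(n)\<close>.

  From dimension \<open>d\<close> to \<open>d + 1\<close>: put one of the ones of a minimal matrix into a second layer. Copies
  of an extremal matrix in all layers give the lower bound; for the upper bound on proper submatrices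
  delete the last one of every line in the new direction.\<close>

section \<open>The Marcus--Tardos theorem for intervals\<close>

text \<open>A row of a double permutation pattern may ask for two ones in one row of
  \<open>A\<close>. Pairing off the ones in each row of \<open>A\<close> turns them into disjoint
  intervals, and such a row of the pattern becomes a single interval. The usual induction on blocks
  then meets an obstacle: an interval may run through many blocks, so the non-empty blocks do not
  inherit the structure of disjoint intervals. A greedy piercing family in every block row takes
  their place; it stays disjoint after contraction, and every interval is charged to one member of
  it. It is never decided which part of \<open>horn k\<close> is minimal. A minimal nonlinear part
  has more than \<open>k\<close> ones, and this already makes the number of minimal matrices
  infinite. Nonlinearity alone provides only one good size \<open>n\<close> for each constant,
  whereas \<omega> concerns all large \<open>n\<close>. A pattern that is not a direct sum closes
  this gap, as copies of one good matrix along the diagonal serve all larger sizes.\<close>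

lemma card_le_fibers:
  assumes "finite B" "f ` A \<subseteq> B" "\<And>y. y \<in> B \<Longrightarrow> card {x\<in>A. f x = y} \<le> m"
  shows "card A \<le> card B * m"
proof (cases "finite A")
  case True
  have "A = (\<Union>y\<in>B. {x\<in>A. f x = y})" using assms(2) by auto
  then have "card A \<le> (\<Sum>y\<in>B. card {x\<in>A. f x = y})"
    using card_UN_le[OF assms(1), of "\<lambda>y. {x\<in>A. f x = y}"] by simp
  also have "\<dots> \<le> card B * m" using sum_bounded_above[of B "\<lambda>y. card {x\<in>A. f x = y}" m] assms(3) by simp
  finally show ?thesis .
qed simp

lemma card_gt_obtain:
  assumes "m < card A"
  obtains x where "x \<in> A"
  using assms by (cases "A = {}") auto

lemma image_selection:
  fixes k :: nat
  assumes "\<And>i. i < k \<Longrightarrow> a i \<in> f ` A"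
  shows "\<exists>h. \<forall>i<k. h i \<in> A \<and> f (h i) = a i"
  using assms by (intro exI[of _ "\<lambda>i. inv_into A f (a i)"]) (simp add: inv_into_into f_inv_into_f)

lemma strict_mono_enumeration:
  fixes X :: "nat set"
  assumes "finite X" "k \<le> card X"
  obtains e where "strict_mono_on {..<k} e" "\<And>i. i < k \<Longrightarrow> e i \<in> X"
proof
  let ?e = "\<lambda>i. sorted_list_of_set X ! i"
  show "strict_mono_on {..<k} ?e"
    using assms strict_sorted_list_of_set[of X]
    by (auto simp: strict_mono_on_def sorted_wrt_iff_nth_less)
  show "?e i \<in> X" if "i < k" for i
    using assms that nth_mem[of i "sorted_list_of_set X"] by simp
qed

text \<open>\<open>D\<close> is the result of repeatedly choosing the interval with the least right endpoint and removing
  all intervals \<open>x\<close> that contain this endpoint; these get \<open>\<phi> x\<close> as their label.\<close>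

definition greedy :: "('a \<Rightarrow> nat) \<Rightarrow> ('a \<Rightarrow> nat) \<Rightarrow> 'a set \<Rightarrow> 'a set \<Rightarrow> ('a \<Rightarrow> 'a) \<Rightarrow> bool" where
  "greedy lo hi F D \<phi> \<longleftrightarrow> D \<subseteq> F \<and>
     (\<forall>x\<in>D. \<forall>y\<in>D. x \<noteq> y \<longrightarrow> hi x < lo y \<or> hi y < lo x) \<and>
     (\<forall>x\<in>F. \<phi> x \<in> D \<and> lo x \<le> hi (\<phi> x) \<and> hi (\<phi> x) \<le> hi x) \<and>
     (\<forall>x\<in>F. \<forall>d\<in>D. hi d < hi (\<phi> x) \<longrightarrow> hi d < lo x)"

text \<open>Induct by removing the interval \<open>x0\<close> that ends first together with all
  intervals starting no later than \<open>hi x0\<close>. These contain the point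
  \<open>hi x0\<close>, as none ends earlier; the remaining ones start after it, so they cannot meet
  \<open>x0\<close>.\<close>

lemma greedy_exists:
  assumes "finite F" "\<And>x. x \<in> F \<Longrightarrow> lo x \<le> hi x"
  shows "\<exists>D \<phi>. greedy lo hi F D \<phi>"
  using assms
proof (induction F rule: finite_psubset_induct)
  case (psubset F)
  show ?case
  proof (cases "F = {}")
    case False
    define x0 where "x0 = arg_min_on hi F"
    have x0: "x0 \<in> F" "\<And>x. x \<in> F \<Longrightarrow> hi x0 \<le> hi x"
      using arg_min_if_finite(1)[OF psubset.hyps(1) False] arg_min_least[OF psubset.hyps(1) False]
      by (auto simp: x0_def)
    define F' where "F' = {x\<in>F. hi x0 < lo x}"
    have "x0 \<notin> F'" using psubset.prems[OF x0(1)] by (simp add: F'_def)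
    then have F': "F' \<subset> F" using x0(1) by (auto simp: F'_def)
    obtain D \<phi> where "greedy lo hi F' D \<phi>" using psubset.IH[OF F'] psubset.prems F' by blast
    then have D: "D \<subseteq> F'" "\<forall>x\<in>D. \<forall>y\<in>D. x \<noteq> y \<longrightarrow> hi x < lo y \<or> hi y < lo x"
      "\<forall>x\<in>F'. \<phi> x \<in> D \<and> lo x \<le> hi (\<phi> x) \<and> hi (\<phi> x) \<le> hi x"
      "\<forall>x\<in>F'. \<forall>d\<in>D. hi d < hi (\<phi> x) \<longrightarrow> hi d < lo x"
      by (simp_all add: greedy_def)
    let ?\<phi> = "\<lambda>x. if x \<in> F' then \<phi> x else x0"
    have "greedy lo hi F (insert x0 D) ?\<phi>"
      unfolding greedy_def
    proof (intro conjI)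
      show "insert x0 D \<subseteq> F" using D(1) F' x0(1) by blast
      show "\<forall>x\<in>insert x0 D. \<forall>y\<in>insert x0 D. x \<noteq> y \<longrightarrow> hi x < lo y \<or> hi y < lo x"
        using D(1,2) by (auto simp: F'_def)
      show "\<forall>x\<in>F. ?\<phi> x \<in> insert x0 D \<and> lo x \<le> hi (?\<phi> x) \<and> hi (?\<phi> x) \<le> hi x"
        using D(3) x0 by (auto simp: F'_def)
      show "\<forall>x\<in>F. \<forall>d\<in>insert x0 D. hi d < hi (?\<phi> x) \<longrightarrow> hi d < lo x"
      proof (intro ballI impI)
        fix x d assume a: "x \<in> F" "d \<in> insert x0 D" "hi d < hi (?\<phi> x)"
        have "hi x0 \<le> hi d" using a(2) D(1) F' x0 by blast
        then have x: "x \<in> F'" using a(3) by (cases "x \<in> F'") auto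
        show "hi d < lo x"
        proof (cases "d = x0")
          case True
          then show ?thesis using x by (simp add: F'_def)
        next
          case False
          then show ?thesis using a x D(4) by auto
        qed
      qed
    qed
    then show ?thesis by blast
  qed (auto simp: greedy_def)
qed

section \<open>Families of disjoint intervals in the rows of an array\<close>

abbreviation row :: "nat \<times> nat \<times> nat \<Rightarrow> nat" where "row x \<equiv> fst x"
abbreviation lo :: "nat \<times> nat \<times> nat \<Rightarrow> nat" where "lo x \<equiv> fst (snd x)"
abbreviation hi :: "nat \<times> nat \<times> nat \<Rightarrow> nat" where "hi x \<equiv> snd (snd x)"

definition row_intervals :: "nat \<Rightarrow> (nat \<times> nat \<times> nat) set \<Rightarrow> bool" where
  "row_intervals n I \<longleftrightarrow> (\<forall>x\<in>I. row x < n \<and> lo x \<le> hi x \<and> hi x < n) \<and>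
     (\<forall>x\<in>I. \<forall>y\<in>I. x \<noteq> y \<and> row x = row y \<longrightarrow> hi x < lo y \<or> hi y < lo x)"

text \<open>\<open>\<sigma> i\<close> is the column rank of the interval chosen for the
  \<open>i\<close>-th row. Equal ranks impose no condition on columns, so empty rows of a pattern
  may later receive rank 0.\<close>

definition has_perm :: "nat \<Rightarrow> (nat \<Rightarrow> nat) \<Rightarrow> (nat \<times> nat \<times> nat) set \<Rightarrow> bool" where
  "has_perm k \<sigma> I \<longleftrightarrow> (\<exists>g. (\<forall>i<k. g i \<in> I) \<and> (\<forall>i j. i < j \<and> j < k \<longrightarrow> row (g i) < row (g j)) \<and>
     (\<forall>i<k. \<forall>j<k. \<sigma> i < \<sigma> j \<longrightarrow> hi (g i) < lo (g j)))"

lemma finite_row_intervals: "row_intervals n I \<Longrightarrow> finite I"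
  by (rule finite_subset[of _ "{..<n} \<times> {..<n} \<times> {..<n}"]) (auto simp: row_intervals_def)

lemma row_intervals_eqI:
  assumes "row_intervals n I" "x \<in> I" "y \<in> I" "row x = row y" "lo x \<le> p" "p \<le> hi x" "lo y \<le> p" "p \<le> hi y"
  shows "x = y"
  using assms unfolding row_intervals_def by (meson leD le_trans order.strict_trans2)

section \<open>Contraction of an array by the factor \<open>s\<close>\<close>

context
  fixes s n k :: nat and \<sigma> :: "nat \<Rightarrow> nat" and I :: "(nat \<times> nat \<times> nat) set"
  assumes I: "row_intervals (s * n) I" and s: "s > 0"
    and av: "\<not> has_perm k \<sigma> I" and \<sigma>: "\<And>i. i < k \<Longrightarrow> \<sigma> i < k"
begin

text \<open>The greedy choice is made in every block row separately, with column coordinates divided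
  by \<open>s\<close>. In terms of block columns, \<open>\<phi> x\<close> ends inside
  \<open>x\<close>, and the members of \<open>D\<close> in the same block row that end earlier do so
  before \<open>x\<close> begins; this will keep apart intervals with different labels.\<close>

lemma block_piercing:
  obtains D \<phi> where "D \<subseteq> I"
    "\<And>x y. \<lbrakk>x \<in> D; y \<in> D; row x div s = row y div s; x \<noteq> y\<rbrakk> \<Longrightarrow> hi x div s < lo y div s \<or> hi y div s < lo x div s"
    "\<And>x. x \<in> I \<Longrightarrow> \<phi> x \<in> D \<and> row (\<phi> x) div s = row x div s \<and> lo x div s \<le> hi (\<phi> x) div s \<and> hi (\<phi> x) div s \<le> hi x div s"
    "\<And>x d. \<lbrakk>x \<in> I; d \<in> D; row d div s = row x div s; hi d div s < hi (\<phi> x) div s\<rbrakk> \<Longrightarrow> hi d div s < lo x div s"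
proof -
  let ?F = "\<lambda>R. {x\<in>I. row x div s = R}"
  let ?lo = "\<lambda>x. lo x div s" and ?hi = "\<lambda>x. hi x div s"
  have "\<exists>D \<phi>. greedy ?lo ?hi (?F R) D \<phi>" for R
    by (rule greedy_exists)
      (use finite_row_intervals[OF I] I in \<open>auto simp: row_intervals_def intro: div_le_mono\<close>)
  then have "\<forall>R. \<exists>p. greedy ?lo ?hi (?F R) (fst p) (snd p)" by simp
  from choice[OF this] obtain p where p: "\<And>R. greedy ?lo ?hi (?F R) (fst (p R)) (snd (p R))" by blast
  define D where "D R = fst (p R)" for R
  define \<phi> where "\<phi> R = snd (p R)" for R
  have G: "greedy ?lo ?hi (?F R) (D R) (\<phi> R)" for R using p by (simp add: D_def \<phi>_def)
  note G' = G[unfolded greedy_def]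
  have D: "\<And>R. D R \<subseteq> ?F R"
    "\<And>R x y. \<lbrakk>x \<in> D R; y \<in> D R; x \<noteq> y\<rbrakk> \<Longrightarrow> ?hi x < ?lo y \<or> ?hi y < ?lo x"
    "\<And>R x. x \<in> ?F R \<Longrightarrow> \<phi> R x \<in> D R \<and> ?lo x \<le> ?hi (\<phi> R x) \<and> ?hi (\<phi> R x) \<le> ?hi x"
    "\<And>R x d. \<lbrakk>x \<in> ?F R; d \<in> D R; ?hi d < ?hi (\<phi> R x)\<rbrakk> \<Longrightarrow> ?hi d < ?lo x"
    using G'[THEN conjunct1] G'[THEN conjunct2, THEN conjunct1] G'[THEN conjunct2, THEN conjunct2, THEN conjunct1]
      G'[THEN conjunct2, THEN conjunct2, THEN conjunct2] by blast+
  have mem: "x \<in> D (row x div s)" if "x \<in> (\<Union>R. D R)" for x using that D(1) by blast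
  show thesis
  proof (rule that[of "\<Union>R. D R" "\<lambda>x. \<phi> (row x div s) x"])
    show "(\<Union>R. D R) \<subseteq> I" using D(1) by blast
    show "hi x div s < lo y div s \<or> hi y div s < lo x div s"
      if "x \<in> (\<Union>R. D R)" "y \<in> (\<Union>R. D R)" "row x div s = row y div s" "x \<noteq> y" for x y
      using mem[OF that(1)] mem[OF that(2)] that(3,4) D(2) by metis
    show "\<phi> (row x div s) x \<in> (\<Union>R. D R) \<and> row (\<phi> (row x div s) x) div s = row x div s \<and>
      lo x div s \<le> hi (\<phi> (row x div s) x) div s \<and> hi (\<phi> (row x div s) x) div s \<le> hi x div s" if "x \<in> I" for x
      using D(3)[of x "row x div s"] D(1)[of "row x div s"] that by blast
    show "hi d div s < lo x div s"
      if "x \<in> I" "d \<in> (\<Union>R. D R)" "row d div s = row x div s" "hi d div s < hi (\<phi> (row x div s) x) div s" for x d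
      using D(4)[of x "row x div s" d] mem[OF that(2)] that by simp
  qed
qed

context
  fixes D \<phi>
  assumes D: "D \<subseteq> I"
    and disj: "\<And>x y. \<lbrakk>x \<in> D; y \<in> D; row x div s = row y div s; x \<noteq> y\<rbrakk> \<Longrightarrow> hi x div s < lo y div s \<or> hi y div s < lo x div s"
    and \<phi>: "\<And>x. x \<in> I \<Longrightarrow> \<phi> x \<in> D \<and> row (\<phi> x) div s = row x div s \<and> lo x div s \<le> hi (\<phi> x) div s \<and> hi (\<phi> x) div s \<le> hi x div s"
    and first: "\<And>x d. \<lbrakk>x \<in> I; d \<in> D; row d div s = row x div s; hi d div s < hi (\<phi> x) div s\<rbrakk> \<Longrightarrow> hi d div s < lo x div s"
begin

lemma block_row_lt: "x \<in> I \<Longrightarrow> row x div s < n \<and> hi x div s < n"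
  using I unfolding row_intervals_def by (metis less_mult_imp_div_less mult.commute)

text \<open>Both would contain the block column in which they end. Hence a member of
  \<open>D\<close> is determined by the block of its right end, and counts over \<open>D\<close>
  become counts over blocks.\<close>

lemma D_eqI:
  assumes "x \<in> D" "y \<in> D" "row x div s = row y div s" "hi x div s = hi y div s"
  shows "x = y"
proof (rule ccontr)
  assume "x \<noteq> y"
  moreover have "lo x \<le> hi x" "lo y \<le> hi y" using assms D I unfolding row_intervals_def by blast+
  then have "lo x div s \<le> hi x div s" "lo y div s \<le> hi y div s" by (simp_all add: div_le_mono)
  ultimately show False using disj[OF assms(1-3)] assms(4) by linarith
qed

text \<open>Blocks have side \<open>s\<close>. The intervals labelled \<open>d\<close> lie in one block row and all meet the block
  column in which \<open>d\<close> ends. As in the proof of Marcus and Tardos, few fibres meet many rows (tall) or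
  have many intervals of one row inside the block (wide), and all others are small.\<close>

definition "fib d = {x\<in>I. \<phi> x = d}"

definition "tall d \<longleftrightarrow> k \<le> card (row ` fib d)"

definition "inner d r = {x\<in>fib d. row x = r \<and> lo x div s = hi d div s \<and> hi x div s = hi d div s}"

definition "wide d \<longleftrightarrow> (\<exists>r. k \<le> card (inner d r))"

lemma div_bounds: "(a::nat) div s = b \<Longrightarrow> b * s \<le> a \<and> a < b * s + s"
  using div_mult_mod_eq[of a s] mod_less_divisor[OF s, of a] by auto

lemma fibD:
  assumes "x \<in> fib d"
  shows "x \<in> I" "row x div s = row d div s" "lo x div s \<le> hi d div s" "hi d div s \<le> hi x div s"
proof -
  show x: "x \<in> I" using assms by (simp add: fib_def)
  have "\<phi> x = d" using assms by (simp add: fib_def)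
  with \<phi>[OF x] show "row x div s = row d div s" "lo x div s \<le> hi d div s" "hi d div s \<le> hi x div s"
    by simp_all
qed

lemma fib_row: "row ` fib d \<subseteq> {row d div s * s..<row d div s * s + s}"
  by (rule image_subsetI) (simp only: atLeastLessThan_iff div_bounds[OF fibD(2)])

lemma finite_fib: "finite (fib d)" using finite_row_intervals[OF I] by (simp add: fib_def)

text \<open>Every interval of the fibre meets the \<open>s\<close> by \<open>s\<close> block in
  which \<open>d\<close> ends, and \<open>?p x\<close> is its first column there. Row and column of
  this cell determine the interval, by disjointness within rows.\<close>

lemma card_fib: "card (fib d) \<le> s * s"
proof -
  let ?B = "hi d div s"
  let ?p = "\<lambda>x. max (lo x) (?B * s)"
  have p: "lo x \<le> ?p x" "?p x \<le> hi x" "?p x \<in> {?B * s..<?B * s + s}" if "x \<in> fib d" for x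
  proof -
    show "lo x \<le> ?p x" by simp
    have "?B * s \<le> hi x div s * s" using fibD(4)[OF that] by simp
    also have "\<dots> \<le> hi x" by simp
    finally show "?p x \<le> hi x" using fibD(1)[OF that] I by (auto simp: row_intervals_def)
    have "lo x < lo x div s * s + s" using div_bounds by blast
    also have "\<dots> \<le> ?B * s + s" using fibD(3)[OF that] by simp
    finally show "?p x \<in> {?B * s..<?B * s + s}" using s by simp
  qed
  have "inj_on (\<lambda>x. (row x, ?p x)) (fib d)"
  proof (rule inj_onI)
    fix x y assume a: "x \<in> fib d" "y \<in> fib d" "(row x, ?p x) = (row y, ?p y)"
    show "x = y"
      by (rule row_intervals_eqI[OF I fibD(1)[OF a(1)] fibD(1)[OF a(2)], of "?p x"])
        (use a p[OF a(1)] p[OF a(2)] in auto)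
  qed
  moreover have "(\<lambda>x. (row x, ?p x)) ` fib d \<subseteq> {row d div s * s..<row d div s * s + s} \<times> {?B * s..<?B * s + s}"
  proof (rule image_subsetI, rule SigmaI)
    fix x assume x: "x \<in> fib d"
    then have "row x \<in> row ` fib d" by (rule imageI)
    with fib_row show "row x \<in> {row d div s * s..<row d div s * s + s}" by (rule subsetD)
    show "?p x \<in> {?B * s..<?B * s + s}" by (rule p(3)[OF x])
  qed
  ultimately have "card (fib d) \<le> card ({row d div s * s..<row d div s * s + s} \<times> {?B * s..<?B * s + s})"
    by (rule card_inj_on_le) (intro finite_SigmaI finite_atLeastLessThan)
  then show ?thesis by (simp only: card_cartesian_product card_atLeastLessThan add_diff_cancel_left')
qed

lemma card_pierced:
  assumes "\<And>z. z \<in> F \<Longrightarrow> z \<in> I \<and> row z = r \<and> lo z \<le> p \<and> p \<le> hi z"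
  shows "card F \<le> 1"
proof -
  have "F \<subseteq> I" using assms by blast
  then have "finite F" using finite_row_intervals[OF I] finite_subset by blast
  moreover have "x = y" if "x \<in> F" "y \<in> F" for x y
    by (rule row_intervals_eqI[OF I, of x y p]) (use assms[OF that(1)] assms[OF that(2)] in auto)
  ultimately show ?thesis by (simp add: card_le_Suc0_iff_eq)
qed

text \<open>Fewer than \<open>k\<close> rows occur. In each of them fewer than \<open>k\<close>
  intervals lie inside the block column, at most one enters it from the left (it contains the first
  column) and at most one leaves it to the right (it contains the last): altogether at most
  \<open>(k - 1) * (k + 1)\<close>.\<close>

lemma card_fib_small:
  assumes "\<not> tall d" "\<not> wide d"
  shows "card (fib d) \<le> k ^ 2"
proof -
  let ?B = "hi d div s"
  have "card {x\<in>fib d. row x = r} \<le> k + 1" for r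
  proof -
    let ?L = "{x\<in>fib d. row x = r \<and> lo x div s < ?B}" and ?R = "{x\<in>fib d. row x = r \<and> ?B < hi x div s}"
    have L: "card ?L \<le> 1"
    proof (rule card_pierced[of _ r "?B * s"])
      fix z assume z: "z \<in> ?L"
      have "lo z < Suc (lo z div s) * s" using div_bounds[of "lo z"] by simp
      also have "\<dots> \<le> ?B * s" using z by (intro mult_le_mono1) auto
      finally have "lo z \<le> ?B * s" by simp
      moreover have "?B * s \<le> hi z div s * s" using z fibD(4)[of z d] by (intro mult_le_mono1) auto
      then have "?B * s \<le> hi z" using div_times_less_eq_dividend le_trans by blast
      ultimately show "z \<in> I \<and> row z = r \<and> lo z \<le> ?B * s \<and> ?B * s \<le> hi z" using z fibD(1) by blast
    qed
    have R: "card ?R \<le> 1"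
    proof (rule card_pierced[of _ r "?B * s + (s - 1)"])
      fix z assume z: "z \<in> ?R"
      have "lo z < lo z div s * s + s" using div_bounds by blast
      also have "\<dots> \<le> ?B * s + s" using z fibD(3)[of z d] by simp
      finally have "lo z \<le> ?B * s + (s - 1)" by simp
      moreover have "Suc ?B * s \<le> hi z div s * s" using z by (intro mult_le_mono1) auto
      then have "?B * s + (s - 1) \<le> hi z div s * s" by simp
      then have "?B * s + (s - 1) \<le> hi z" using div_times_less_eq_dividend le_trans by blast
      ultimately show "z \<in> I \<and> row z = r \<and> lo z \<le> ?B * s + (s - 1) \<and> ?B * s + (s - 1) \<le> hi z"
        using z fibD(1) by blast
    qed
    have "card (inner d r) < k" using assms(2) unfolding wide_def by (meson not_le)
    moreover have "k > 0" using assms(2) unfolding wide_def by auto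
    moreover have "{x\<in>fib d. row x = r} \<subseteq> inner d r \<union> ?L \<union> ?R"
    proof
      fix x assume x: "x \<in> {x\<in>fib d. row x = r}"
      then have "lo x div s \<le> ?B" "?B \<le> hi x div s" using fibD by blast+
      then show "x \<in> inner d r \<union> ?L \<union> ?R" using x unfolding inner_def mem_Collect_eq Un_iff by linarith
    qed
    then have "card {x\<in>fib d. row x = r} \<le> card (inner d r \<union> ?L \<union> ?R)"
      using finite_fib by (intro card_mono finite_UnI) (simp_all add: inner_def)
    then have "card {x\<in>fib d. row x = r} \<le> card (inner d r) + card ?L + card ?R"
      using card_Un_le[of "inner d r \<union> ?L" ?R] card_Un_le[of "inner d r" ?L] by linarith
    ultimately show ?thesis using L R by linarith
  qed
  then have "card (fib d) \<le> card (row ` fib d) * (k + 1)"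
    by (intro card_le_fibers) (auto simp: finite_fib)
  also have "\<dots> \<le> (k - 1) * (k + 1)" using assms(1) unfolding tall_def
    by (intro mult_right_mono) auto
  also have "\<dots> \<le> k ^ 2" by (cases k) (auto simp: power2_eq_square)
  finally show ?thesis .
qed

text \<open>Pigeonhole over the set of rows met by the fibre, one of \<open>2 ^ s\<close> subsets.
  If more than \<open>2 * k\<close> fibres of one block row share this set, \<open>k\<close> common
  rows and \<open>2 * k\<close> end columns form a grid with an interval at each crossing, from
  which a copy of \<open>\<sigma>\<close> can be read off.\<close>

lemma card_tall: "card {d\<in>D. row d div s = R \<and> tall d} \<le> 2 ^ s * (2 * k)"
proof -
  let ?TD = "{d\<in>D. row d div s = R \<and> tall d}"
  have "card ?TD \<le> card (Pow {R * s..<R * s + s}) * (2 * k)"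
  proof (rule card_le_fibers)
    show "(\<lambda>d. row ` fib d) ` ?TD \<subseteq> Pow {R * s..<R * s + s}"
    proof (rule image_subsetI)
      fix d assume "d \<in> ?TD"
      then show "row ` fib d \<in> Pow {R * s..<R * s + s}" using fib_row[of d] by simp
    qed
    fix T
    let ?E = "{d\<in>?TD. row ` fib d = T}"
    show "card ?E \<le> 2 * k"
    proof (rule ccontr)
      assume "\<not> ?thesis"
      then have E: "2 * k < card ?E" by simp
      then obtain d0 where "d0 \<in> ?E" by (rule card_gt_obtain)
      then have T: "k \<le> card T" "finite T" using finite_fib[of d0] by (auto simp: tall_def)
      have "inj_on (\<lambda>d. hi d div s) ?E" by (rule inj_onI) (use D_eqI in simp)
      then have "2 * k \<le> card ((\<lambda>d. hi d div s) ` ?E)" using E by (simp add: card_image)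
      moreover have "finite ((\<lambda>d. hi d div s) ` ?E)" using E card_ge_0_finite[of ?E] by simp
      ultimately obtain bs where bs: "strict_mono_on {..<2 * k} bs" "\<And>j. j < 2 * k \<Longrightarrow> bs j \<in> (\<lambda>d. hi d div s) ` ?E"
        using strict_mono_enumeration by blast
      obtain d where "\<forall>j<2 * k. d j \<in> ?E \<and> hi (d j) div s = bs j"
        using image_selection[OF bs(2)] by (rule exE)
      note d = this[rule_format]
      obtain t where t: "strict_mono_on {..<k} t" "\<And>i. i < k \<Longrightarrow> t i \<in> T"
        using strict_mono_enumeration[OF T(2,1)] by blast
      have x_ex: "\<exists>x. x \<in> fib (d j) \<and> row x = t i" if "i < k" "j < 2 * k" for i j
      proof -
        have "t i \<in> row ` fib (d j)" using t(2)[OF that(1)] d[OF that(2)] by simp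
        then obtain x where "t i = row x" "x \<in> fib (d j)" by (rule imageE)
        then show ?thesis by metis
      qed
      define x where "x i j = (SOME x. x \<in> fib (d j) \<and> row x = t i)" for i j
      have x: "x i j \<in> fib (d j)" "row (x i j) = t i" if "i < k" "j < 2 * k" for i j
        using someI_ex[OF x_ex[OF that]] by (simp_all add: x_def)
      have xd: "x i j \<in> I" "row (x i j) div s = R" "lo (x i j) div s \<le> bs j" "bs j \<le> hi (x i j) div s"
        "\<phi> (x i j) = d j" if "i < k" "j < 2 * k" for i j
        using fibD[OF x(1)[OF that]] d[OF that(2)] x(1)[OF that] by (simp_all add: fib_def)
      \<comment> \<open>An interval starts after the end blocks of all earlier labels, but it may
        extend far to the right of the end block of its own label.\<close>
      have later: "bs j < lo (x i j') div s" if "i < k" "j < j'" "j' < 2 * k" for i j j'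
      proof -
        have "bs j < bs j'" using bs(1) that by (simp add: strict_mono_on_def)
        then show ?thesis
          using first[of "x i j'" "d j"] xd[OF that(1,3)] d[of j] d[of j'] that by simp
      qed
      \<comment> \<open>Only even columns of the grid are used. The interval of the same row in the
        next odd column separates \<open>x i (2 * \<sigma> i)\<close> from all chosen intervals of
        larger rank; this is where the factor 2 comes from.\<close>
      have "has_perm k \<sigma> I"
        unfolding has_perm_def
      proof (intro exI[of _ "\<lambda>i. x i (2 * \<sigma> i)"] conjI allI impI)
        fix i assume "i < k"
        then show "x i (2 * \<sigma> i) \<in> I" using xd(1) \<sigma> by simp
      next
        fix i j assume "i < j \<and> j < k"
        then show "row (x i (2 * \<sigma> i)) < row (x j (2 * \<sigma> j))"
          using t(1) x(2) \<sigma> by (simp add: strict_mono_on_def)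
      next
        fix i j assume a: "i < k" "j < k" "\<sigma> i < \<sigma> j"
        define y where "y = x i (2 * \<sigma> i)"
        define z where "z = x i (2 * \<sigma> i + 1)"
        have b: "2 * \<sigma> i < 2 * k" "2 * \<sigma> i + 1 < 2 * k" "2 * \<sigma> j < 2 * k" 
          using \<sigma>[OF a(1)] \<sigma>[OF a(2)] by linarith+
        have "y \<noteq> z" using later[OF a(1), of "2 * \<sigma> i" "2 * \<sigma> i + 1"] b xd(3)[OF a(1) b(1)]
          by (metis leD less_add_one y_def z_def)
        then have "hi y < lo z \<or> hi z < lo y"
          using I xd(1)[OF a(1) b(1)] xd(1)[OF a(1) b(2)] x(2)[OF a(1) b(1)] x(2)[OF a(1) b(2)]
          unfolding row_intervals_def y_def z_def by metis
        moreover have "\<not> hi z < lo y"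
        proof
          assume "hi z < lo y"
          then have "hi z div s \<le> lo y div s" by (simp add: div_le_mono)
          moreover have "lo y div s \<le> bs (2 * \<sigma> i)" using xd(3)[OF a(1) b(1)] by (simp add: y_def)
          moreover have "bs (2 * \<sigma> i) < bs (2 * \<sigma> i + 1)" using bs(1) b by (simp add: strict_mono_on_def)
          moreover have "bs (2 * \<sigma> i + 1) \<le> hi z div s" using xd(4)[OF a(1) b(2)] by (simp add: z_def)
          ultimately show False by linarith
        qed
        ultimately have "hi y div s \<le> lo z div s" by (simp add: div_le_mono)
        also have "\<dots> \<le> bs (2 * \<sigma> i + 1)" using xd(3)[OF a(1) b(2)] by (simp add: z_def)
        also have "\<dots> < lo (x j (2 * \<sigma> j)) div s" using later[OF a(2) _ b(3), of "2 * \<sigma> i + 1"] a by simp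
        finally show "hi (x i (2 * \<sigma> i)) < lo (x j (2 * \<sigma> j))"
          unfolding y_def by (meson div_le_mono leD leI)
      qed
      then show False using av by blast
    qed
  qed simp
  then show ?thesis by (simp add: card_Pow)
qed

text \<open>Pigeonhole over the pairs of end points of the inner intervals in the row
  \<open>\<rho> d\<close>, a subset of the \<open>s * s\<close> pairs of columns in the block. More
  than \<open>k\<close> members of \<open>D\<close> sharing the set \<open>W\<close> provide
  \<open>k\<close> rows with the same \<open>k\<close> disjoint column intervals, so an interval of
  any rank is available in each of these rows.\<close>

lemma card_wide: "card {d\<in>D. hi d div s = B \<and> wide d} \<le> 2 ^ (s * s) * k"
proof -
  let ?WD = "{d\<in>D. hi d div s = B \<and> wide d}"
  define \<rho> where "\<rho> d = (SOME r. k \<le> card (inner d r))" for d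
  have \<rho>: "k \<le> card (inner d (\<rho> d))" if "wide d" for d
    using that someI_ex[of "\<lambda>r. k \<le> card (inner d r)"] by (simp add: wide_def \<rho>_def)
  define Z where "Z d = snd ` inner d (\<rho> d)" for d
  have card_Z: "card (Z d) = card (inner d (\<rho> d))" for d
    unfolding Z_def by (rule card_image) (auto simp: inj_on_def inner_def)
  have k: "k > 0" using av by (auto simp: has_perm_def)
  have innerD: "x \<in> I" "row x = \<rho> d" "row x div s = row d div s" if "x \<in> inner d (\<rho> d)" for x d
    using that fibD[of x d] by (simp_all add: inner_def)
  let ?S = "{B * s..<B * s + s}"
  have "card ?WD \<le> card (Pow (?S \<times> ?S)) * k"
  proof (rule card_le_fibers)
    show "Z ` ?WD \<subseteq> Pow (?S \<times> ?S)"
    proof (rule image_subsetI, rule PowI, rule subsetI)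
      fix d w assume d: "d \<in> ?WD" and "w \<in> Z d"
      then obtain x where x: "x \<in> inner d (\<rho> d)" "w = snd x" by (auto simp: Z_def)
      then have "lo x div s = B" "hi x div s = B" using d by (auto simp: inner_def)
      then show "w \<in> ?S \<times> ?S" using div_bounds x(2) by (metis SigmaI atLeastLessThan_iff prod.collapse)
    qed
    fix W
    let ?E = "{d\<in>?WD. Z d = W}"
    show "card ?E \<le> k"
    proof (rule ccontr)
      assume "\<not> ?thesis"
      then have E: "k < card ?E" by simp
      \<comment> \<open>Equal rows \<open>\<rho> d\<close> would put both members of
        \<open>D\<close> into one block row with the same end column.\<close>
      have "inj_on \<rho> ?E"
      proof (rule inj_onI)
        fix d d' assume a: "d \<in> ?E" "d' \<in> ?E" "\<rho> d = \<rho> d'"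
        then have "0 < card (inner d (\<rho> d))" "0 < card (inner d' (\<rho> d'))"
          using \<rho>[of d] \<rho>[of d'] k by auto
        then obtain x y where "x \<in> inner d (\<rho> d)" "y \<in> inner d' (\<rho> d')"
          using card_gt_obtain by metis
        then have "row d div s = row d' div s" using innerD a(3) by metis
        then show "d = d'" using D_eqI a by simp
      qed
      then have "k \<le> card (\<rho> ` ?E)" using E by (simp add: card_image)
      moreover have "finite (\<rho> ` ?E)" using E card_ge_0_finite[of ?E] by simp
      ultimately obtain t where t: "strict_mono_on {..<k} t" "\<And>i. i < k \<Longrightarrow> t i \<in> \<rho> ` ?E"
        using strict_mono_enumeration by blast
      obtain d0 where d0: "d0 \<in> ?E" using E by (rule card_gt_obtain)
      then have ZW: "Z d0 = W" by simp
      have W: "k \<le> card W" using d0 \<rho>[of d0] card_Z[of d0] by simp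
      have W_disj: "snd v < fst w" if "v \<in> W" "w \<in> W" "snd v < snd w" for v w
      proof -
        have "v \<in> Z d0" "w \<in> Z d0" using that ZW by simp_all
        then obtain x y where xy: "x \<in> inner d0 (\<rho> d0)" "y \<in> inner d0 (\<rho> d0)" "v = snd x" "w = snd y"
          by (auto simp: Z_def)
        have "x \<noteq> y" using xy that(3) by auto
        then have "hi x < lo y \<or> hi y < lo x" "lo x \<le> hi x"
          using innerD[OF xy(1)] innerD[OF xy(2)] I unfolding row_intervals_def by metis+
        moreover have "hi x < hi y" using that(3) xy(3,4) by simp
        ultimately have "hi x < lo y" by linarith
        then show ?thesis using xy(3,4) by simp
      qed
      have "inj_on snd W"
      proof (rule inj_onI)
        fix v w assume a: "v \<in> W" "w \<in> W" "snd v = snd w"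
        have "v \<in> Z d0" "w \<in> Z d0" using a ZW by simp_all
        then obtain x y where xy: "x \<in> inner d0 (\<rho> d0)" "y \<in> inner d0 (\<rho> d0)" "v = snd x" "w = snd y"
          by (auto simp: Z_def)
        have "x = y"
        proof (rule row_intervals_eqI[OF I])
          show "lo x \<le> hi x" "lo y \<le> hi x" using innerD[OF xy(1)] innerD[OF xy(2)] I xy a(3)
            unfolding row_intervals_def by metis+
          show "hi x \<le> hi y" using xy a(3) by simp
        qed (use innerD[OF xy(1)] innerD[OF xy(2)] in simp_all)
        then show "v = w" using xy by simp
      qed
      moreover have "finite W" using W k card_ge_0_finite[of W] by simp
      ultimately obtain u where u: "strict_mono_on {..<k} u" "\<And>i. i < k \<Longrightarrow> u i \<in> snd ` W"
        using strict_mono_enumeration[of "snd ` W" k] W by (auto simp: card_image)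
      obtain w where "\<forall>i<k. w i \<in> W \<and> snd (w i) = u i" using image_selection[OF u(2)] by (rule exE)
      note w = this[rule_format]
      have "has_perm k \<sigma> I"
        unfolding has_perm_def
      proof (intro exI[of _ "\<lambda>i. (t i, w (\<sigma> i))"] conjI allI impI)
        fix i assume i: "i < k"
        from t(2)[OF i] obtain d where d: "t i = \<rho> d" "d \<in> ?E" by (rule imageE)
        then have "w (\<sigma> i) \<in> snd ` inner d (\<rho> d)" using w[OF \<sigma>[OF i]] by (simp add: Z_def)
        then obtain x where "w (\<sigma> i) = snd x" "x \<in> inner d (\<rho> d)" by (rule imageE)
        then show "(t i, w (\<sigma> i)) \<in> I" using innerD[of x d] d(1) by (metis prod.collapse)
      next
        fix i j assume "i < j \<and> j < k"
        then show "row (t i, w (\<sigma> i)) < row (t j, w (\<sigma> j))" using t(1) by (simp add: strict_mono_on_def)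
      next
        fix i j assume "i < k" "j < k" "\<sigma> i < \<sigma> j"
        then show "hi (t i, w (\<sigma> i)) < lo (t j, w (\<sigma> j))"
          using W_disj[of "w (\<sigma> i)" "w (\<sigma> j)"] w \<sigma> u(1) by (simp add: strict_mono_on_def)
      qed
      then show False using av by blast
    qed
  qed simp
  then show ?thesis by (simp add: card_Pow card_cartesian_product)
qed

text \<open>Small fibres cost \<open>k ^ 2\<close> each and the others at most \<open>s * s\<close>.
  Tall ones are bounded in each of the \<open>n\<close> block rows and wide ones in each of the
  \<open>n\<close> block columns, so their total contribution is linear in \<open>n\<close>.\<close>

lemma card_contracted: "card I \<le> k ^ 2 * card D + s * s * (2 ^ s * (2 * k) + 2 ^ (s * s) * k) * n"
proof -
  have finD: "finite D" using D finite_row_intervals[OF I] finite_subset by blast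
  have bl: "row d div s < n" "hi d div s < n" if "d \<in> D" for d using that D block_row_lt by blast+
  have "card {d\<in>D. tall d} \<le> card {..<n} * (2 ^ s * (2 * k))"
  proof (rule card_le_fibers)
    show "(\<lambda>d. row d div s) ` {d\<in>D. tall d} \<subseteq> {..<n}" using bl by blast
    fix R
    have "{d \<in> {d\<in>D. tall d}. row d div s = R} = {d\<in>D. row d div s = R \<and> tall d}" by blast
    then show "card {d \<in> {d\<in>D. tall d}. row d div s = R} \<le> 2 ^ s * (2 * k)" using card_tall by simp
  qed simp
  moreover have "card {d\<in>D. wide d} \<le> card {..<n} * (2 ^ (s * s) * k)"
  proof (rule card_le_fibers)
    show "(\<lambda>d. hi d div s) ` {d\<in>D. wide d} \<subseteq> {..<n}" using bl by blast
    fix B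
    have "{d \<in> {d\<in>D. wide d}. hi d div s = B} = {d\<in>D. hi d div s = B \<and> wide d}" by blast
    then show "card {d \<in> {d\<in>D. wide d}. hi d div s = B} \<le> 2 ^ (s * s) * k" using card_wide by simp
  qed simp
  moreover have "{d\<in>D. tall d \<or> wide d} = {d\<in>D. tall d} \<union> {d\<in>D. wide d}" by blast
  then have "card {d\<in>D. tall d \<or> wide d} \<le> card {d\<in>D. tall d} + card {d\<in>D. wide d}"
    by (simp only: card_Un_le)
  ultimately have tw: "card {d\<in>D. tall d \<or> wide d} \<le> (2 ^ s * (2 * k) + 2 ^ (s * s) * k) * n"
    by (simp add: algebra_simps)
  have "I = (\<Union>d\<in>D. fib d)" using \<phi> by (auto simp: fib_def)
  then have "card I \<le> (\<Sum>d\<in>D. card (fib d))" using card_UN_le[OF finD, of fib] by simp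
  also have "\<dots> \<le> (\<Sum>d\<in>D. k ^ 2 + (if tall d \<or> wide d then s * s else 0))"
    by (rule sum_mono) (use card_fib card_fib_small in \<open>auto intro: trans_le_add2\<close>)
  also have "\<dots> = k ^ 2 * card D + s * s * card {d\<in>D. tall d \<or> wide d}"
    using finD by (simp add: sum.distrib sum.inter_filter[symmetric])
  also have "\<dots> \<le> k ^ 2 * card D + s * s * ((2 ^ s * (2 * k) + 2 ^ (s * s) * k) * n)"
    using tw by (intro add_left_mono mult_left_mono) auto
  finally show ?thesis by (simp only: mult.assoc)
qed

text \<open>A strict inequality between quotients by \<open>s\<close> implies one between the
  numbers, so a copy of \<open>\<sigma>\<close> among the contracted members of \<open>D\<close>
  lifts to one in \<open>I\<close>.\<close>

lemma contraction:
  "\<exists>J. row_intervals n J \<and> \<not> has_perm k \<sigma> J \<and> card J = card D"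
proof -
  define c where "c x = (row x div s, lo x div s, hi x div s)" for x :: "nat \<times> nat \<times> nat"
  have c: "row (c x) = row x div s" "lo (c x) = lo x div s" "hi (c x) = hi x div s" for x
    by (simp_all add: c_def)
  have "row_intervals n (c ` D)"
    unfolding row_intervals_def
  proof (intro conjI ballI impI)
    fix y assume "y \<in> c ` D"
    then obtain x where x: "x \<in> D" "y = c x" by blast
    then have "lo x \<le> hi x" using I D unfolding row_intervals_def by blast
    then show "row y < n" "lo y \<le> hi y" "hi y < n"
      using block_row_lt[of x] x D by (auto simp: c div_le_mono)
  next
    fix y z assume "y \<in> c ` D" "z \<in> c ` D" "y \<noteq> z \<and> row y = row z"
    moreover from this obtain u v where uv: "u \<in> D" "v \<in> D" "y = c u" "z = c v" by blast
    ultimately show "hi y < lo z \<or> hi z < lo y" using disj[OF uv(1,2)] by (auto simp only: c)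
  qed
  moreover have "\<not> has_perm k \<sigma> (c ` D)"
  proof
    assume "has_perm k \<sigma> (c ` D)"
    then obtain g where g: "\<forall>i<k. g i \<in> c ` D" "\<forall>i j. i < j \<and> j < k \<longrightarrow> row (g i) < row (g j)"
      "\<forall>i<k. \<forall>j<k. \<sigma> i < \<sigma> j \<longrightarrow> hi (g i) < lo (g j)" unfolding has_perm_def by blast
    obtain h where "\<forall>i<k. h i \<in> D \<and> c (h i) = g i"
      using image_selection[OF g(1)[rule_format]] by (rule exE)
    note h = this[rule_format]
    have less: "a < b" if "a div s < b div s" for a b :: nat using that by (meson div_le_mono leD leI)
    have "has_perm k \<sigma> I"
      unfolding has_perm_def
    proof (intro exI[of _ h] conjI allI impI)
      show "h i \<in> I" if "i < k" for i using h that D by blast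
      show "row (h i) < row (h j)" if "i < j \<and> j < k" for i j
      proof (rule less)
        have "row (c (h i)) < row (c (h j))" using g(2) h that by (metis order.strict_trans)
        then show "row (h i) div s < row (h j) div s" by (simp add: c)
      qed
      show "hi (h i) < lo (h j)" if "i < k" "j < k" "\<sigma> i < \<sigma> j" for i j
      proof (rule less)
        have "hi (c (h i)) < lo (c (h j))" using g(3) h that by metis
        then show "hi (h i) div s < lo (h j) div s" by (simp add: c)
      qed
    qed
    then show False using av by blast
  qed
  moreover have "card (c ` D) = card D"
    by (rule card_image, rule inj_onI) (use D_eqI in \<open>metis c(1,3)\<close>)
  ultimately show ?thesis by blast
qed

end

lemma contraction_step:
  "\<exists>J. row_intervals n J \<and> \<not> has_perm k \<sigma> J \<and>
     card I \<le> k ^ 2 * card J + s * s * (2 ^ s * (2 * k) + 2 ^ (s * s) * k) * n"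
proof -
  obtain D \<phi> where D: "D \<subseteq> I"
    "\<And>x y. \<lbrakk>x \<in> D; y \<in> D; row x div s = row y div s; x \<noteq> y\<rbrakk> \<Longrightarrow> hi x div s < lo y div s \<or> hi y div s < lo x div s"
    "\<And>x. x \<in> I \<Longrightarrow> \<phi> x \<in> D \<and> row (\<phi> x) div s = row x div s \<and> lo x div s \<le> hi (\<phi> x) div s \<and> hi (\<phi> x) div s \<le> hi x div s"
    "\<And>x d. \<lbrakk>x \<in> I; d \<in> D; row d div s = row x div s; hi d div s < hi (\<phi> x) div s\<rbrakk> \<Longrightarrow> hi d div s < lo x div s"
    using block_piercing by blast
  have "\<exists>J. row_intervals n J \<and> \<not> has_perm k \<sigma> J \<and> card J = card D"
    using D by (rule contraction)
  moreover have "card I \<le> k ^ 2 * card D + s * s * (2 ^ s * (2 * k) + 2 ^ (s * s) * k) * n"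
    using D by (rule card_contracted)
  ultimately show ?thesis by metis
qed

end

text \<open>An interval version of the Marcus--Tardos theorem: degenerate intervals give the theorem
  for permutation matrices.\<close>

theorem marcus_tardos_intervals:
  assumes \<sigma>: "\<And>i. i < k \<Longrightarrow> \<sigma> i < k"
  shows "\<exists>C. \<forall>n I. row_intervals n I \<and> \<not> has_perm k \<sigma> I \<longrightarrow> card I \<le> C * n"
proof (cases "k = 0")
  case True
  then show ?thesis by (simp add: has_perm_def)
next
  case False
  \<comment> \<open>The recursion reads \<open>card I \<le> k ^ 2 * card J + (K - 1) * n\<close>.
    Its solution is linear once \<open>s\<close> exceeds \<open>k ^ 2\<close>, and for
    \<open>s = k ^ 2 + 1\<close> the bound \<open>K * s ^ j\<close> reproduces itself
    exactly.\<close>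
  define s where "s = k ^ 2 + 1"
  have s: "s \<ge> 2" using False by (simp add: s_def Suc_leI)
  define K where "K = s * s * (2 ^ s * (2 * k) + 2 ^ (s * s) * k) + 1"
  have pow: "card I \<le> K * s ^ j" if "row_intervals (s ^ j) I" "\<not> has_perm k \<sigma> I" for I j
    using that
  proof (induction j arbitrary: I)
    case 0
    then have "I \<subseteq> {(0, 0, 0)}" by (force simp: row_intervals_def)
    then have "card I \<le> 1" using card_mono[of "{(0::nat, 0::nat, 0::nat)}" I] by simp
    then show ?case by (simp add: K_def)
  next
    case (Suc j)
    obtain J where J: "row_intervals (s ^ j) J" "\<not> has_perm k \<sigma> J"
      "card I \<le> k ^ 2 * card J + s * s * (2 ^ s * (2 * k) + 2 ^ (s * s) * k) * s ^ j"
      using contraction_step[of s "s ^ j" I k \<sigma>] Suc.prems s \<sigma> by auto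
    have "k ^ 2 * card J \<le> k ^ 2 * (K * s ^ j)" using Suc.IH[OF J(1,2)] by simp
    then have "card I \<le> k ^ 2 * (K * s ^ j) + K * s ^ j"
      using J(3) by (simp only: K_def add_mult_distrib)
    also have "\<dots> = K * s ^ Suc j" by (simp add: s_def algebra_simps)
    finally show ?case .
  qed
  have "card I \<le> K * s * n" if I: "row_intervals n I" "\<not> has_perm k \<sigma> I" for I n
  proof (cases "n = 0")
    case True
    then have "I = {}" using I(1) by (auto simp: row_intervals_def)
    then show ?thesis by simp
  next
    case n: False
    define j where "j = (LEAST j. n \<le> s ^ j)"
    have "\<exists>j. n \<le> s ^ j" using s by (meson less_exp less_imp_le order_trans power_mono zero_le)
    then have j: "n \<le> s ^ j" unfolding j_def by (rule LeastI_ex)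
    have "s ^ j \<le> s * n"
    proof (cases j)
      case 0
      then show ?thesis using n s by simp
    next
      case (Suc i)
      then have "\<not> n \<le> s ^ i" using not_less_Least[of i "\<lambda>j. n \<le> s ^ j"] by (simp add: j_def[symmetric])
      then show ?thesis using Suc by simp
    qed
    moreover have "row_intervals (s ^ j) I" using I(1) j by (force simp: row_intervals_def)
    then have "card I \<le> K * s ^ j" using pow I(2) by blast
    ultimately show ?thesis by (metis le_trans mult.assoc mult_le_mono2)
  qed
  then show ?thesis by blast
qed

section \<open>Linear planar patterns\<close>

text \<open>Only rows and columns that contain ones of \<open>S\<close> are mapped. Unlike in
  \<open>contains\<close>, empty rows and columns of a pattern have no effect, so subsets of a
  pattern can be treated as patterns without renumbering.\<close>

definition emb :: "(nat \<times> nat) set \<Rightarrow> (nat \<times> nat) set \<Rightarrow> bool" where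
  "emb S A \<longleftrightarrow> (\<exists>f g. strict_mono_on (fst ` S) f \<and> strict_mono_on (snd ` S) g \<and> (\<forall>p\<in>S. (f (fst p), g (snd p)) \<in> A))"

lemma embI:
  assumes "\<And>p q. \<lbrakk>p \<in> S; q \<in> S; fst p < fst q\<rbrakk> \<Longrightarrow> f (fst p) < f (fst q)"
    and "\<And>p q. \<lbrakk>p \<in> S; q \<in> S; snd p < snd q\<rbrakk> \<Longrightarrow> g (snd p) < g (snd q)"
    and "\<And>p. p \<in> S \<Longrightarrow> (f (fst p), g (snd p)) \<in> A"
  shows "emb S A"
  unfolding emb_def
proof (intro exI conjI ballI)
  show "strict_mono_on (fst ` S) f" "strict_mono_on (snd ` S) g"
    using assms(1,2) by (force intro!: strict_mono_onI)+
qed (use assms(3) in simp)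

lemma embE:
  assumes "emb S A"
  obtains f g where "\<And>p q. \<lbrakk>p \<in> S; q \<in> S; fst p < fst q\<rbrakk> \<Longrightarrow> f (fst p) < f (fst q)"
    "\<And>p q. \<lbrakk>p \<in> S; q \<in> S; snd p < snd q\<rbrakk> \<Longrightarrow> g (snd p) < g (snd q)"
    "\<And>p. p \<in> S \<Longrightarrow> (f (fst p), g (snd p)) \<in> A"
proof -
  obtain f g where fg: "strict_mono_on (fst ` S) f" "strict_mono_on (snd ` S) g" "\<forall>p\<in>S. (f (fst p), g (snd p)) \<in> A"
    using assms unfolding emb_def by blast
  show thesis
    by (rule that[of f g]) (use fg(3) strict_mono_onD[OF fg(1)] strict_mono_onD[OF fg(2)] in auto)
qed

definition lin :: "(nat \<times> nat) set \<Rightarrow> bool" where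
  "lin S \<longleftrightarrow> (\<exists>C. \<forall>n. \<forall>A\<subseteq>{..<n} \<times> {..<n}. \<not> emb S A \<longrightarrow> card A \<le> C * n)"

lemma emb_trans:
  assumes "emb T S" "emb S A"
  shows "emb T A"
proof -
  from assms(1) obtain f g where f: "\<And>p q. \<lbrakk>p \<in> T; q \<in> T; fst p < fst q\<rbrakk> \<Longrightarrow> f (fst p) < f (fst q)"
    "\<And>p q. \<lbrakk>p \<in> T; q \<in> T; snd p < snd q\<rbrakk> \<Longrightarrow> g (snd p) < g (snd q)"
    "\<And>p. p \<in> T \<Longrightarrow> (f (fst p), g (snd p)) \<in> S" by (rule embE) blast
  from assms(2) obtain f' g' where f': "\<And>p q. \<lbrakk>p \<in> S; q \<in> S; fst p < fst q\<rbrakk> \<Longrightarrow> f' (fst p) < f' (fst q)"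
    "\<And>p q. \<lbrakk>p \<in> S; q \<in> S; snd p < snd q\<rbrakk> \<Longrightarrow> g' (snd p) < g' (snd q)"
    "\<And>p. p \<in> S \<Longrightarrow> (f' (fst p), g' (snd p)) \<in> A" by (rule embE) blast
  show ?thesis
  proof (rule embI[of T "f' \<circ> f" "g' \<circ> g"])
    fix p q assume pq: "p \<in> T" "q \<in> T"
    note m = f(3)[OF pq(1)] f(3)[OF pq(2)]
    show "(f' \<circ> f) (fst p) < (f' \<circ> f) (fst q)" if "fst p < fst q"
      using f'(1)[OF m] f(1)[OF pq that] by simp
    show "(g' \<circ> g) (snd p) < (g' \<circ> g) (snd q)" if "snd p < snd q"
      using f'(2)[OF m] f(2)[OF pq that] by simp
  next
    fix p assume "p \<in> T"
    then show "((f' \<circ> f) (fst p), (g' \<circ> g) (snd p)) \<in> A" using f'(3)[OF f(3)] by simp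
  qed
qed

lemma emb_swap: "emb (prod.swap ` S) (prod.swap ` A) \<longleftrightarrow> emb S A"
proof -
  have sw: "emb (prod.swap ` S) (prod.swap ` A)" if "emb S A" for S A
  proof -
    from that obtain f g where f: "\<And>p q. \<lbrakk>p \<in> S; q \<in> S; fst p < fst q\<rbrakk> \<Longrightarrow> f (fst p) < f (fst q)"
      "\<And>p q. \<lbrakk>p \<in> S; q \<in> S; snd p < snd q\<rbrakk> \<Longrightarrow> g (snd p) < g (snd q)"
      "\<And>p. p \<in> S \<Longrightarrow> (f (fst p), g (snd p)) \<in> A" by (rule embE) blast
    show ?thesis
    proof (rule embI[of _ g f])
      fix p q assume "p \<in> prod.swap ` S" "q \<in> prod.swap ` S"
      then obtain p' q' where "p' \<in> S" "q' \<in> S" "p = prod.swap p'" "q = prod.swap q'" by blast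
      then show "fst p < fst q \<Longrightarrow> g (fst p) < g (fst q)" "snd p < snd q \<Longrightarrow> f (snd p) < f (snd q)"
        using f(1,2)[of p' q'] by simp_all
    next
      fix p assume "p \<in> prod.swap ` S"
      then obtain p' where "p' \<in> S" "p = prod.swap p'" by blast
      then show "(g (fst p), f (snd p)) \<in> prod.swap ` A"
        using f(3)[of p'] by (metis fst_swap snd_swap swap_simp image_eqI)
    qed
  qed
  from sw[of S A] sw[of "prod.swap ` S" "prod.swap ` A"] show ?thesis by (auto simp: image_image)
qed

lemma lin_emb:
  assumes "emb T S" "lin S"
  shows "lin T"
  using assms emb_trans unfolding lin_def by meson

lemma lin_swap:
  assumes "lin (prod.swap ` S)"
  shows "lin S"
proof -
  obtain C where C: "\<And>n A. A \<subseteq> {..<n} \<times> {..<n} \<Longrightarrow> \<not> emb (prod.swap ` S) A \<Longrightarrow> card A \<le> C * n"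
    using assms unfolding lin_def by blast
  have "card A \<le> C * n" if "A \<subseteq> {..<n} \<times> {..<n}" "\<not> emb S A" for A n
  proof -
    have "prod.swap ` A \<subseteq> {..<n} \<times> {..<n}" using that(1) by auto
    then have "card (prod.swap ` A) \<le> C * n" using C that(2) emb_swap by blast
    then show ?thesis by (simp add: card_image)
  qed
  then show ?thesis unfolding lin_def by blast
qed

text \<open>Pairing off the least two elements repeatedly leaves at most one element over. This
  turns the ones of a row into disjoint intervals at the cost of a factor 2 and one extra one per
  row.\<close>

lemma disjoint_pairs:
  fixes X :: "nat set"
  assumes "finite X"
  shows "\<exists>P. finite P \<and> (\<forall>p\<in>P. fst p \<in> X \<and> snd p \<in> X \<and> fst p < snd p) \<and>
    (\<forall>p\<in>P. \<forall>q\<in>P. p \<noteq> q \<longrightarrow> snd p < fst q \<or> snd q < fst p) \<and> card X \<le> 2 * card P + 1"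
  using assms
proof (induction X rule: finite_psubset_induct)
  case (psubset X)
  show ?case
  proof (cases "card X \<le> 1")
    case True
    then show ?thesis by (intro exI[of _ "{}"]) auto
  next
    case False
    define a where "a = Min X"
    define b where "b = Min (X - {a})"
    have a: "a \<in> X" "\<And>x. x \<in> X \<Longrightarrow> a \<le> x"
      using False psubset.hyps unfolding a_def by (auto intro!: Min_in)
    have "card (X - {a}) = card X - 1" using a(1) by simp
    then have "X - {a} \<noteq> {}" using False by (metis card.empty diff_is_0_eq)
    then have b: "b \<in> X - {a}" "\<And>x. x \<in> X - {a} \<Longrightarrow> b \<le> x"
      using psubset.hyps Min_in[of "X - {a}"] by (simp_all add: b_def)
    define X' where "X' = X - {a} - {b}"
    have X': "X' \<subset> X" "\<And>x. x \<in> X' \<Longrightarrow> b < x" "X' \<subseteq> X"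
      using a b by (auto simp: X'_def order.strict_iff_order)
    have ab: "a < b" using a b by (auto simp: order.strict_iff_order)
    have card: "card X = card X' + 2" using a(1) b(1) psubset.hyps False by (simp add: X'_def)
    obtain P where P: "finite P" "\<forall>p\<in>P. fst p \<in> X' \<and> snd p \<in> X' \<and> fst p < snd p"
      "\<forall>p\<in>P. \<forall>q\<in>P. p \<noteq> q \<longrightarrow> snd p < fst q \<or> snd q < fst p" "card X' \<le> 2 * card P + 1"
      using psubset.IH[OF X'(1)] by blast
    have new: "(a, b) \<notin> P" using P(2) X'(2) by force
    show ?thesis
    proof (intro exI[of _ "insert (a, b) P"] conjI)
      show "finite (insert (a, b) P)" using P(1) by simp
      show "\<forall>p\<in>insert (a, b) P. fst p \<in> X \<and> snd p \<in> X \<and> fst p < snd p"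
        using P(2) X'(3) a b ab by auto
      show "\<forall>p\<in>insert (a, b) P. \<forall>q\<in>insert (a, b) P. p \<noteq> q \<longrightarrow> snd p < fst q \<or> snd q < fst p"
        using P(2,3) X'(2) by auto
      show "card X \<le> 2 * card (insert (a, b) P) + 1" using new P(1,4) card by simp
    qed
  qed
qed

text \<open>Contains the double permutation matrices: in every row the ones are adjacent (up to empty
  columns), so there are at most two of them.\<close>

definition double_perm :: "(nat \<times> nat) set \<Rightarrow> bool" where
  "double_perm S \<longleftrightarrow> inj_on snd S \<and>
     (\<forall>i c c'. (i, c) \<in> S \<and> (i, c') \<in> S \<longrightarrow> (\<forall>p\<in>S. \<not> (c < snd p \<and> snd p < c')))"

text \<open>The rank of a row of \<open>S\<close> is its leftmost column. Intervals between paired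
  ones of \<open>A\<close> that realise these ranks carry a copy of \<open>S\<close>: a row of
  \<open>S\<close> has at most two ones, the leftmost going to the left end of its interval and a
  second one to the right end.\<close>

lemma double_perm_lin:
  assumes "finite S" "double_perm S"
  shows "lin S"
proof -
  have inj: "i = i'" if "(i, c) \<in> S" "(i', c) \<in> S" for i i' c
    using assms(2) that unfolding double_perm_def inj_on_def by force
  have adj: False if "(i, c) \<in> S" "(i, c') \<in> S" "p \<in> S" "c < snd p" "snd p < c'" for i c c' p
    using assms(2) that unfolding double_perm_def by blast
  define k where "k = Suc (Max (insert 0 (fst ` S \<union> snd ` S)))"
  have bd: "i < k" "c < k" if "(i, c) \<in> S" for i c
    using that assms(1) by (force simp: k_def less_Suc_eq_le intro!: Max_ge)+
  define \<sigma> where "\<sigma> i = (if i \<in> fst ` S then LEAST c. (i, c) \<in> S else 0)" for i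
  have \<sigma>: "(i, \<sigma> i) \<in> S" "\<sigma> i \<le> c" if "(i, c) \<in> S" for i c
  proof -
    have "i \<in> fst ` S" using that by force
    then show "(i, \<sigma> i) \<in> S" "\<sigma> i \<le> c" using that LeastI[of "\<lambda>c. (i, c) \<in> S"] Least_le[of "\<lambda>c. (i, c) \<in> S"]
      by (auto simp: \<sigma>_def)
  qed
  have "\<sigma> i < k" for i
  proof (cases "i \<in> fst ` S")
    case True
    then show ?thesis using \<sigma> bd by fastforce
  qed (simp add: \<sigma>_def k_def)
  then obtain C where C: "\<And>n I. row_intervals n I \<Longrightarrow> \<not> has_perm k \<sigma> I \<Longrightarrow> card I \<le> C * n"
    using marcus_tardos_intervals[of k \<sigma>] by blast
  have "card A \<le> (2 * C + 1) * n" if A: "A \<subseteq> {..<n} \<times> {..<n}" "\<not> emb S A" for A n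
  proof -
    have fin: "finite {c. (r, c) \<in> A}" for r
      by (rule finite_subset[of _ "{..<n}"]) (use A(1) in auto)
    define P where "P r = (SOME P. finite P \<and> (\<forall>p\<in>P. fst p \<in> {c. (r, c) \<in> A} \<and> snd p \<in> {c. (r, c) \<in> A} \<and> fst p < snd p) \<and>
      (\<forall>p\<in>P. \<forall>q\<in>P. p \<noteq> q \<longrightarrow> snd p < fst q \<or> snd q < fst p) \<and> card {c. (r, c) \<in> A} \<le> 2 * card P + 1)" for r
    have P: "finite (P r)" "\<forall>p\<in>P r. (r, fst p) \<in> A \<and> (r, snd p) \<in> A \<and> fst p < snd p"
      "\<forall>p\<in>P r. \<forall>q\<in>P r. p \<noteq> q \<longrightarrow> snd p < fst q \<or> snd q < fst p" "card {c. (r, c) \<in> A} \<le> 2 * card (P r) + 1" for r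
      using someI_ex[OF disjoint_pairs[OF fin[of r]], folded P_def] by simp_all
    define I where "I = Sigma {..<n} P"
    have "row_intervals n I"
      unfolding row_intervals_def
    proof (intro conjI ballI impI)
      fix x assume "x \<in> I"
      then have "snd x \<in> P (fst x)" "fst x < n" by (auto simp: I_def)
      moreover from bspec[OF P(2) this(1)]
      have "(row x, hi x) \<in> A" "lo x < hi x" by simp_all
      ultimately show "row x < n" "lo x \<le> hi x" "hi x < n" using subsetD[OF A(1)] by auto
    next
      fix x y assume "x \<in> I" "y \<in> I" "x \<noteq> y \<and> row x = row y"
      moreover from this have "snd x \<in> P (fst x)" "snd y \<in> P (fst x)" "snd x \<noteq> snd y"
        by (auto simp: I_def prod_eq_iff)
      ultimately show "hi x < lo y \<or> hi y < lo x" using P(3)[of "fst x"] by blast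
    qed
    moreover have "\<not> has_perm k \<sigma> I"
    proof
      assume "has_perm k \<sigma> I"
      then obtain h where h0: "\<forall>i<k. h i \<in> I" "\<forall>i j. i < j \<and> j < k \<longrightarrow> row (h i) < row (h j)"
        "\<forall>i<k. \<forall>j<k. \<sigma> i < \<sigma> j \<longrightarrow> hi (h i) < lo (h j)"
        unfolding has_perm_def by (elim exE conjE) (rule that)
      note h = h0(1)[rule_format] h0(2)[rule_format, OF conjI] h0(3)[rule_format]
      have hA: "(row (h i), lo (h i)) \<in> A" "(row (h i), hi (h i)) \<in> A" "lo (h i) < hi (h i)" if "i < k" for i
      proof -
        have "snd (h i) \<in> P (row (h i))" using h(1)[OF that] by (auto simp: I_def)
        from bspec[OF P(2) this] have "(row (h i), lo (h i)) \<in> A \<and> (row (h i), hi (h i)) \<in> A \<and> lo (h i) < hi (h i)" .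
        then show "(row (h i), lo (h i)) \<in> A" "(row (h i), hi (h i)) \<in> A" "lo (h i) < hi (h i)"
          by simp_all
      qed
      define \<rho> where "\<rho> c = (THE i. (i, c) \<in> S)" for c
      have \<rho>: "\<rho> c = i" if "(i, c) \<in> S" for i c
        unfolding \<rho>_def using that inj by (intro the_equality) auto
      define g where "g c = (if c = \<sigma> (\<rho> c) then lo (h (\<rho> c)) else hi (h (\<rho> c)))" for c
      have gv: "g c = (if c = \<sigma> i then lo (h i) else hi (h i))" if "(i, c) \<in> S" for i c
        by (simp only: g_def \<rho>[OF that])
      have g: "g c < g c'" if i: "(i, c) \<in> S" "(i', c') \<in> S" and cc: "c < c'" for i c i' c'
      proof -
        note s = \<sigma>[OF i(1)] \<sigma>[OF i(2)]
        show "g c < g c'"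
        proof (cases "i = i'")
          case True
          then have "\<sigma> i < c'" using s cc by simp
          moreover have "\<not> \<sigma> i < c" using adj[OF s(1) i(2)[folded True] i(1)] cc by auto
          then have "c = \<sigma> i" using s(2) by simp
          ultimately show ?thesis using gv[OF i(1)] gv[OF i(2)] True hA(3)[of i] bd[OF i(1)] by simp
        next
          case False
          have "\<sigma> i' \<noteq> c" using inj[OF s(3)] i(1) False by blast
          \<comment> \<open>A one of row \<open>i\<close> strictly between two ones of row
            \<open>i'\<close> is excluded, so columns from different rows are ordered like the
            leftmost columns of these rows.\<close>
          moreover have "\<not> \<sigma> i' < c" using adj[OF s(3) i(2) i(1)] cc by auto
          ultimately have "\<sigma> i < \<sigma> i'" using s(2) by linarith
          then have "hi (h i) < lo (h i')" using h(3)[OF bd(1)[OF i(1)] bd(1)[OF i(2)]] by simp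
          moreover have "g c \<le> hi (h i)" "lo (h i') \<le> g c'"
            using gv[OF i(1)] gv[OF i(2)] hA(3)[of i] hA(3)[of i'] bd[OF i(1)] bd[OF i(2)] by simp_all
          ultimately show ?thesis by simp
        qed
      qed
      have "emb S A"
      proof (rule embI[of S "\<lambda>i. row (h i)" g])
        fix p q assume "p \<in> S" "q \<in> S"
        then have pq: "(fst p, snd p) \<in> S" "(fst q, snd q) \<in> S" by simp_all
        show "row (h (fst p)) < row (h (fst q))" if "fst p < fst q" using h(2) bd[OF pq(2)] that by blast
        show "g (snd p) < g (snd q)" if "snd p < snd q" using g[OF pq that] .
      next
        fix p assume "p \<in> S"
        then have p: "(fst p, snd p) \<in> S" by simp
        show "(row (h (fst p)), g (snd p)) \<in> A" using gv[OF p] hA[of "fst p"] bd[OF p] by simp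
      qed
      then show False using A(2) by blast
    qed
    ultimately have "card I \<le> C * n" by (rule C)
    moreover have "card I = (\<Sum>r<n. card (P r))" unfolding I_def using P(1) by (intro card_SigmaI) auto
    moreover have "A = Sigma {..<n} (\<lambda>r. {c. (r, c) \<in> A})" using A(1) by auto
    then have "card A = (\<Sum>r<n. card {c. (r, c) \<in> A})" using fin by (metis card_SigmaI finite_lessThan)
    then have "card A \<le> (\<Sum>r<n. 2 * card (P r) + 1)" using P(4) by (simp add: sum_mono)
    moreover have "(\<Sum>r<n. 2 * card (P r) + 1) = 2 * (\<Sum>r<n. card (P r)) + n"
      unfolding sum.distrib by (simp add: sum_distrib_left)
    ultimately show ?thesis by (simp add: algebra_simps)
  qed
  then show ?thesis unfolding lin_def by blast
qed

text \<open>Keszegh's gluing argument: split the ones of \<open>A\<close> according to whether a copy of \<open>X\<close> lies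
  strictly to the upper left.\<close>

lemma lin_direct_sum:
  assumes XY: "\<And>p q. p \<in> X \<Longrightarrow> q \<in> Y \<Longrightarrow> fst p < fst q \<and> snd p < snd q"
    and X: "lin (insert (u, v) X)" "\<And>p. p \<in> X \<Longrightarrow> fst p < u \<and> snd p < v"
    and Y: "lin (insert (u', v') Y)" "\<And>q. q \<in> Y \<Longrightarrow> u' < fst q \<and> v' < snd q"
  shows "lin (X \<union> Y)"
proof -
  obtain C where C: "\<And>n A. A \<subseteq> {..<n} \<times> {..<n} \<Longrightarrow> \<not> emb (insert (u, v) X) A \<Longrightarrow> card A \<le> C * n"
    using X(1) unfolding lin_def by blast
  obtain C' where C': "\<And>n A. A \<subseteq> {..<n} \<times> {..<n} \<Longrightarrow> \<not> emb (insert (u', v') Y) A \<Longrightarrow> card A \<le> C' * n"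
    using Y(1) unfolding lin_def by blast
  have "card A \<le> (C + C') * n" if A: "A \<subseteq> {..<n} \<times> {..<n}" "\<not> emb (X \<union> Y) A" for A n
  proof -
    define M where "M = {p\<in>A. emb X (A \<inter> {..<fst p} \<times> {..<snd p})}"
    \<comment> \<open>The image of \<open>(u, v)\<close> would have the image of \<open>X\<close>
      strictly to its upper left and so lie in \<open>M\<close>.\<close>
    have "\<not> emb (insert (u, v) X) (A - M)"
    proof
      assume "emb (insert (u, v) X) (A - M)"
      then obtain f g where f: "\<And>p q. \<lbrakk>p \<in> insert (u, v) X; q \<in> insert (u, v) X; fst p < fst q\<rbrakk> \<Longrightarrow> f (fst p) < f (fst q)"
        "\<And>p q. \<lbrakk>p \<in> insert (u, v) X; q \<in> insert (u, v) X; snd p < snd q\<rbrakk> \<Longrightarrow> g (snd p) < g (snd q)"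
        "\<And>p. p \<in> insert (u, v) X \<Longrightarrow> (f (fst p), g (snd p)) \<in> A - M" by (rule embE) blast
      have "emb X (A \<inter> {..<f u} \<times> {..<g v})"
      proof (rule embI[of X f g])
        fix p assume p: "p \<in> X"
        then have "f (fst p) < f u" "g (snd p) < g v" using f(1,2)[of p "(u, v)"] X(2)[OF p] by auto
        then show "(f (fst p), g (snd p)) \<in> A \<inter> {..<f u} \<times> {..<g v}" using f(3)[of p] p by simp
      qed (use f(1,2) in auto)
      then show False using f(3)[of "(u, v)"] by (simp add: M_def)
    qed
    then have 1: "card (A - M) \<le> C * n" using A(1) by (intro C) auto
    have "\<not> emb (insert (u', v') Y) M"
    proof
      assume "emb (insert (u', v') Y) M"
      then obtain f g where f: "\<And>p q. \<lbrakk>p \<in> insert (u', v') Y; q \<in> insert (u', v') Y; fst p < fst q\<rbrakk> \<Longrightarrow> f (fst p) < f (fst q)"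
        "\<And>p q. \<lbrakk>p \<in> insert (u', v') Y; q \<in> insert (u', v') Y; snd p < snd q\<rbrakk> \<Longrightarrow> g (snd p) < g (snd q)"
        "\<And>p. p \<in> insert (u', v') Y \<Longrightarrow> (f (fst p), g (snd p)) \<in> M" by (rule embE) blast
      have big: "f u' < f (fst q)" "g v' < g (snd q)" if "q \<in> Y" for q
        using f(1,2)[of "(u', v')" q] Y(2)[OF that] that by auto
      have "emb X (A \<inter> {..<f u'} \<times> {..<g v'})" using f(3)[of "(u', v')"] by (simp add: M_def)
      then obtain f' g' where f': "\<And>p q. \<lbrakk>p \<in> X; q \<in> X; fst p < fst q\<rbrakk> \<Longrightarrow> f' (fst p) < f' (fst q)"
        "\<And>p q. \<lbrakk>p \<in> X; q \<in> X; snd p < snd q\<rbrakk> \<Longrightarrow> g' (snd p) < g' (snd q)"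
        "\<And>p. p \<in> X \<Longrightarrow> (f' (fst p), g' (snd p)) \<in> A \<inter> {..<f u'} \<times> {..<g v'}" by (rule embE) blast
      have small: "f' (fst p) < f u'" "g' (snd p) < g v'" if "p \<in> X" for p
        using f'(3)[OF that] by auto
      \<comment> \<open>Rows and columns of \<open>X\<close> come before those of \<open>Y\<close>,
        so the two copies can be combined: that of \<open>X\<close> lies strictly to the upper left
        of \<open>(f u', g v')\<close> and that of \<open>Y\<close> strictly to its lower
        right.\<close>
      define F where "F i = (if i \<in> fst ` X then f' i else f i)" for i
      define G where "G j = (if j \<in> snd ` X then g' j else g j)" for j
      have FX: "F (fst p) = f' (fst p)" "G (snd p) = g' (snd p)" if "p \<in> X" for p
        using that by (simp_all add: F_def G_def)
      have FY: "F (fst q) = f (fst q)" "G (snd q) = g (snd q)" if "q \<in> Y" for q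
      proof -
        have "fst q \<notin> fst ` X" "snd q \<notin> snd ` X" using XY[OF _ that] by (metis imageE less_irrefl)+
        then show "F (fst q) = f (fst q)" "G (snd q) = g (snd q)" by (simp_all add: F_def G_def)
      qed
      have "emb (X \<union> Y) A"
      proof (rule embI[of _ F G])
        fix p q assume pq: "p \<in> X \<union> Y" "q \<in> X \<union> Y"
        show "F (fst p) < F (fst q)" if lt: "fst p < fst q"
        proof -
          consider "p \<in> X" "q \<in> X" | "p \<in> X" "q \<in> Y" | "p \<in> Y" "q \<in> Y"
            using pq XY[of q p] lt by force
          then show ?thesis
          proof cases
            case 1
            then show ?thesis using f'(1)[OF _ _ lt] FX by simp
          next
            case 2
            then show ?thesis using FX(1) FY(1) small(1)[of p] big(1)[of q] by simp
          next
            case 3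
            then show ?thesis using f(1)[OF _ _ lt] FY by simp
          qed
        qed
        show "G (snd p) < G (snd q)" if lt: "snd p < snd q"
        proof -
          consider "p \<in> X" "q \<in> X" | "p \<in> X" "q \<in> Y" | "p \<in> Y" "q \<in> Y"
            using pq XY[of q p] lt by force
          then show ?thesis
          proof cases
            case 1
            then show ?thesis using f'(2)[OF _ _ lt] FX by simp
          next
            case 2
            then show ?thesis using FX(2) FY(2) small(2)[of p] big(2)[of q] by simp
          next
            case 3
            then show ?thesis using f(2)[OF _ _ lt] FY by simp
          qed
        qed
      next
        fix p assume "p \<in> X \<union> Y"
        then show "(F (fst p), G (snd p)) \<in> A"
        proof
          assume "p \<in> X"
          then show ?thesis using FX[of p] f'(3)[of p] by simp
        next
          assume "p \<in> Y"
          then show ?thesis using FY[of p] f(3)[of p] by (simp add: M_def)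
        qed
      qed
      then show False using A(2) by blast
    qed
    then have 2: "card M \<le> C' * n" using A(1) by (intro C') (auto simp: M_def)
    have "M \<subseteq> A" by (auto simp: M_def)
    moreover have "finite A" using A(1) finite_subset by blast
    ultimately have "card A = card (A - M) + card M"
      using card_mono[of A M] finite_subset[of M A] by (simp add: card_Diff_subset)
    then show ?thesis using 1 2 by (simp add: algebra_simps)
  qed
  then show ?thesis unfolding lin_def by blast
qed

section \<open>A family of nonlinear patterns\<close>

text \<open>The \<open>n log n\<close> matrices \<open>[[M, I], [0, M]]\<close>: the position \<open>(i, j)\<close> is a one iff \<open>j\<close> arises from
  \<open>i\<close> by changing one binary digit from 0 to 1.\<close>

fun cube :: "nat \<Rightarrow> (nat \<times> nat) set" where
  "cube 0 = {}"
| "cube (Suc m) = cube m \<union> (\<lambda>i. (i, i + 2 ^ m)) ` {..<2 ^ m} \<union> (\<lambda>(i, j). (i + 2 ^ m, j + 2 ^ m)) ` cube m"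

lemma cube_bound: "(i, j) \<in> cube m \<Longrightarrow> i < 2 ^ m \<and> j < 2 ^ m"
  by (induction m arbitrary: i j) fastforce+

lemma finite_cube: "finite (cube m)"
  by (induction m) auto

lemma card_cube: "2 * card (cube m) = m * 2 ^ m"
proof (induction m)
  case (Suc m)
  let ?D = "(\<lambda>i. (i, i + 2 ^ m)) ` {..<2 ^ m :: nat}" and ?S = "(\<lambda>(i, j). (i + 2 ^ m, j + 2 ^ m)) ` cube m"
  have "cube m \<inter> ?D = {}" "(cube m \<union> ?D) \<inter> ?S = {}" using cube_bound by fastforce+
  then have "card (cube (Suc m)) = card (cube m) + card ?D + card ?S"
    by (simp add: card_Un_disjoint finite_cube)
  moreover have "card ?D = 2 ^ m" by (subst card_image) (auto simp: inj_on_def)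
  moreover have "card ?S = card (cube m)" by (rule card_image) (auto simp: inj_on_def)
  ultimately show ?case using Suc.IH by simp
qed simp

lemma cube_Suc_cases:
  assumes "(i, j) \<in> cube (Suc m)"
  shows "i < 2 ^ m \<and> j < 2 ^ m \<and> (i, j) \<in> cube m \<or> i < 2 ^ m \<and> j = i + 2 ^ m \<or>
    2 ^ m \<le> i \<and> 2 ^ m \<le> j \<and> (i - 2 ^ m, j - 2 ^ m) \<in> cube m"
  using assms cube_bound by auto

text \<open>The inversion graph of the permutation behind \<open>horn k\<close> is a path of pairs and links: the link
  \<open>(4 * j + 6, 4 * j)\<close> is to the lower left of the \<open>j\<close>-th and of the next pair, and the inner pairs are
  inverted. That the inner pairs are inverted prevents an embedding in which both of their ones lie in the
  upper right quadrant \<open>I\<close> of the hypercube matrix.\<close>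

definition horn :: "nat \<Rightarrow> (nat \<times> nat) set" where
  "horn k = {(0, 2), (0, 3), (4 * k + 4, 4 * k + 6), (4 * k + 5, 4 * k + 6)} \<union>
     (\<Union>j\<in>{1..k}. {(4 * j, 4 * j + 3), (4 * j + 1, 4 * j + 2)}) \<union> (\<lambda>j. (4 * j + 6, 4 * j)) ` {..k}"

lemma horn_cases:
  assumes "p \<in> horn k"
  obtains "p = (0, 2)" | "p = (0, 3)" | "p = (4 * k + 4, 4 * k + 6)" | "p = (4 * k + 5, 4 * k + 6)"
    | j where "1 \<le> j" "j \<le> k" "p = (4 * j, 4 * j + 3)"
    | j where "1 \<le> j" "j \<le> k" "p = (4 * j + 1, 4 * j + 2)"
    | j where "j \<le> k" "p = (4 * j + 6, 4 * j)"
  using assms unfolding horn_def by (elim UnE UN_E imageE insertE emptyE) auto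

lemma finite_horn: "finite (horn k)" by (simp add: horn_def)

text \<open>Induction on \<open>m\<close> over the quadrants \<open>[[M, I], [0, M]]\<close>. If all
  rows lie in the lower half or all columns in the left half, the whole copy is in one quadrant
  \<open>M\<close>. Otherwise its position is forced along the chain: the ones of \<open>I\<close>
  increase in both coordinates, so neither a horizontal, nor a vertical, nor an inverted pair lies
  in \<open>I\<close>; and the lower left quadrant is empty, so a one in the left half is also in
  the upper half.\<close>

lemma horn_not_emb_cube: "\<not> emb (horn k) (cube m)"
proof
  assume "emb (horn k) (cube m)"
  then obtain f g where fg: "\<And>p q. \<lbrakk>p \<in> horn k; q \<in> horn k; fst p < fst q\<rbrakk> \<Longrightarrow> f (fst p) < f (fst q)"
    "\<And>p q. \<lbrakk>p \<in> horn k; q \<in> horn k; snd p < snd q\<rbrakk> \<Longrightarrow> g (snd p) < g (snd q)"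
    "\<And>p. p \<in> horn k \<Longrightarrow> (f (fst p), g (snd p)) \<in> cube m" by (rule embE) blast
  then show False
  proof (induction m arbitrary: f g)
    case 0
    have "(0, 2) \<in> horn k" by (simp add: horn_def)
    from "0.prems"(3)[OF this] show ?case by simp
  next
    case (Suc m)
    note f_less = Suc.prems(1) and g_less = Suc.prems(2) and mem = Suc.prems(3)
    note split = mem[THEN cube_Suc_cases]
    have H: "(0, 2) \<in> horn k" "(0, 3) \<in> horn k"
      and V: "(4 * k + 4, 4 * k + 6) \<in> horn k" "(4 * k + 5, 4 * k + 6) \<in> horn k"
      and T: "\<And>j. \<lbrakk>1 \<le> j; j \<le> k\<rbrakk> \<Longrightarrow> (4 * j, 4 * j + 3) \<in> horn k \<and> (4 * j + 1, 4 * j + 2) \<in> horn k"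
      and B: "\<And>j. j \<le> k \<Longrightarrow> (4 * j + 6, 4 * j) \<in> horn k"
      by (auto simp: horn_def)
    have f0: "f 0 \<le> f (fst p)" and gl: "g (snd p) \<le> g (4 * k + 6)" if p: "p \<in> horn k" for p
    proof -
      show "f 0 \<le> f (fst p)" using f_less[OF H(1) p] by (cases "fst p = 0") auto
      have "snd p \<le> 4 * k + 6" using p by (elim horn_cases) auto
      then show "g (snd p) \<le> g (4 * k + 6)" using g_less[OF p V(1)] by (cases "snd p = 4 * k + 6") auto
    qed
    consider "2 ^ m \<le> f 0" | "g (4 * k + 6) < 2 ^ m" | "f 0 < 2 ^ m" "2 ^ m \<le> g (4 * k + 6)" by linarith
    then show False
    proof cases
      case 1
      then have f: "2 ^ m \<le> f (fst p)" if "p \<in> horn k" for p using f0[OF that] by simp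
      then have g: "2 ^ m \<le> g (snd p) \<and> (f (fst p) - 2 ^ m, g (snd p) - 2 ^ m) \<in> cube m" if "p \<in> horn k" for p
        using split[OF that] that by fastforce
      show False
      proof (rule Suc.IH[of "\<lambda>i. f i - 2 ^ m" "\<lambda>j. g j - 2 ^ m"])
        fix p q assume "p \<in> horn k" "q \<in> horn k" "fst p < fst q"
        then show "f (fst p) - 2 ^ m < f (fst q) - 2 ^ m" using f_less f by (simp add: diff_less_mono)
      next
        fix p q assume "p \<in> horn k" "q \<in> horn k" "snd p < snd q"
        then show "g (snd p) - 2 ^ m < g (snd q) - 2 ^ m" using g_less g by (simp add: diff_less_mono)
      qed (use g in blast)
    next
      case 2
      then have g: "g (snd p) < 2 ^ m" if "p \<in> horn k" for p using gl[OF that] by simp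
      then have "(f (fst p), g (snd p)) \<in> cube m" if "p \<in> horn k" for p
        using split[OF that] that by fastforce
      then show False using Suc.IH[of f g] f_less g_less by blast
    next
      case 3
      have right: "g j = f i + 2 ^ m" if "(i, j) \<in> horn k" "f i < 2 ^ m" "2 ^ m \<le> g j" for i j
        using split[OF that(1)] that by auto
      have left: "f i < 2 ^ m" if "(i, j) \<in> horn k" "g j < 2 ^ m" for i j
        using split[OF that(1)] that by auto
      \<comment> \<open>Row 0 lies in the upper half, and \<open>I\<close> has only one one per row,
        so the two ones of the horizontal pair are not both in \<open>I\<close>.\<close>
      have "g 2 < 2 ^ m"
      proof (rule ccontr)
        assume "\<not> g 2 < 2 ^ m"
        moreover have "g 2 < g 3" using g_less[OF H] by simp
        ultimately show False using right[OF H(1)] right[OF H(2)] 3(1) by simp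
      qed
      \<comment> \<open>Each link pulls the next pair into the upper half. Being inverted, this pair
        has its left one outside \<open>I\<close>, which pulls the following link to the left half
        and hence to the upper half.\<close>
      have "f (4 * j + 6) < 2 ^ m" if "j \<le> k" for j
        using that
      proof (induction j)
        case 0
        have "g 0 < g 2" using g_less[OF B[of 0] H(1)] by simp
        then show ?case using left[OF B[of 0]] \<open>g 2 < 2 ^ m\<close> by simp
      next
        case (Suc j)
        define i where "i = Suc j"
        have i: "1 \<le> i" "i \<le> k" using Suc.prems by (simp_all add: i_def)
        note Ti = T[OF i, THEN conjunct1] T[OF i, THEN conjunct2]
        have "f (4 * j + 6) < 2 ^ m" using Suc by simp
        moreover have "f (4 * i) < f (4 * i + 1)" "f (4 * i + 1) < f (4 * j + 6)" "g (4 * i + 2) < g (4 * i + 3)"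
          using f_less[OF Ti] f_less[OF Ti(2) B[of j]] g_less[OF Ti(2,1)] i by (simp_all add: i_def)
        ultimately have "g (4 * i + 2) < 2 ^ m"
          using right[OF Ti(1)] right[OF Ti(2)] by (cases "g (4 * i + 2) < 2 ^ m") simp_all
        moreover have "g (4 * i) < g (4 * i + 2)" using g_less[OF B[OF i(2)] Ti(2)] by simp
        ultimately show ?case using left[OF B[OF i(2)]] by (simp add: i_def)
      qed
      \<comment> \<open>By the last link the vertical pair lies in the upper half; its column is in
        the right half, so \<open>I\<close> would have two ones in one column.\<close>
      then have "f (4 * k + 6) < 2 ^ m" by simp
      moreover have "f (4 * k + 4) < f (4 * k + 5)" "f (4 * k + 5) < f (4 * k + 6)"
        using f_less[OF V] f_less[OF V(2) B[of k]] by simp_all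
      ultimately show False using right[OF V(1)] right[OF V(2)] 3(2) by simp
    qed
  qed
qed

lemma not_lin_horn: "\<not> lin (horn k)"
proof
  assume "lin (horn k)"
  then obtain C where C: "\<And>n A. A \<subseteq> {..<n} \<times> {..<n} \<Longrightarrow> \<not> emb (horn k) A \<Longrightarrow> card A \<le> C * n"
    unfolding lin_def by blast
  \<comment> \<open>\<open>cube m\<close> has \<open>m * 2 ^ m / 2\<close> ones, more than
    \<open>C * 2 ^ m\<close> as soon as \<open>m > 2 * C\<close>.\<close>
  define m where "m = 2 * C + 1"
  have "cube m \<subseteq> {..<2 ^ m} \<times> {..<2 ^ m}" using cube_bound by auto
  then have "card (cube m) \<le> C * 2 ^ m" using horn_not_emb_cube by (rule C)
  then have "m * 2 ^ m \<le> (2 * C) * 2 ^ m" using card_cube[of m] by linarith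
  then have "m \<le> 2 * C" by (subst (asm) mult_le_cancel2) simp
  then show False by (simp add: m_def)
qed

text \<open>The vertical pair contains the only two ones in a common column, and the horizontal pair
  the only two in a common row; the columns 2 and 3 of the latter have nothing between them.\<close>

lemma double_perm_horn:
  assumes "S \<subseteq> horn k" "\<not> {(4 * k + 4, 4 * k + 6), (4 * k + 5, 4 * k + 6)} \<subseteq> S"
  shows "double_perm S"
  unfolding double_perm_def
proof (intro conjI allI impI ballI inj_onI)
  fix p q assume pq: "p \<in> S" "q \<in> S" "snd p = snd q"
  have "p \<in> horn k" "q \<in> horn k" using pq assms(1) by auto
  then show "p = q" using assms(2) pq by (elim horn_cases) (simp_all, presburger+)
next
  fix i c c' p assume a: "(i, c) \<in> S \<and> (i, c') \<in> S" and p: "p \<in> S"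
  show "\<not> (c < snd p \<and> snd p < c')"
  proof
    assume l: "c < snd p \<and> snd p < c'"
    have "(i, c) \<in> horn k" "(i, c') \<in> horn k" using a assms(1) by auto
    then have "c = 2 \<and> c' = 3" using l by (elim horn_cases) (simp_all, presburger+)
    then show False using l by linarith
  qed
qed

lemma double_perm_horn_swap:
  assumes "S \<subseteq> horn k" "\<not> {(0, 2), (0, 3)} \<subseteq> S"
  shows "double_perm (prod.swap ` S)"
  unfolding double_perm_def
proof (intro conjI allI impI ballI inj_onI)
  fix p q assume pq: "p \<in> prod.swap ` S" "q \<in> prod.swap ` S" "snd p = snd q"
  then obtain p' q' where s: "p' \<in> S" "q' \<in> S" "p = prod.swap p'" "q = prod.swap q'" by blast
  then have "fst p' = fst q'" using pq by simp
  moreover have "p' \<in> horn k" "q' \<in> horn k" using s assms(1) by auto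
  ultimately have "p' = q'" using assms(2) s(1,2) by (elim horn_cases) (simp_all, presburger+)
  then show "p = q" using s by simp
next
  fix i c c' p assume a: "(i, c) \<in> prod.swap ` S \<and> (i, c') \<in> prod.swap ` S" and p: "p \<in> prod.swap ` S"
  show "\<not> (c < snd p \<and> snd p < c')"
  proof
    assume l: "c < snd p \<and> snd p < c'"
    have "(c, i) \<in> horn k" "(c', i) \<in> horn k" using a assms(1) by auto
    then have "c = 4 * k + 4 \<and> c' = 4 * k + 5" using l by (elim horn_cases) (simp_all, presburger+)
    then show False using l by linarith
  qed
qed

lemma double_perm_insert:
  assumes S: "double_perm S" and u: "\<And>p. p \<in> S \<Longrightarrow> fst p \<noteq> u"
    and v: "(\<forall>p\<in>S. snd p < v) \<or> (\<forall>p\<in>S. v < snd p)"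
  shows "double_perm (insert (u, v) S)"
  unfolding double_perm_def
proof (intro conjI allI impI ballI)
  have "v \<notin> snd ` S" using v by auto
  then show "inj_on snd (insert (u, v) S)" using S by (auto simp: double_perm_def)
  fix i c c' p
  assume a: "(i, c) \<in> insert (u, v) S \<and> (i, c') \<in> insert (u, v) S" and p: "p \<in> insert (u, v) S"
  show "\<not> (c < snd p \<and> snd p < c')"
  proof (cases "i = u")
    case True
    then have "c = c'" using a u[of "(i, c)"] u[of "(i, c')"] by auto
    then show ?thesis by simp
  next
    case False
    then have ic: "(i, c) \<in> S" "(i, c') \<in> S" using a by auto
    show ?thesis
    proof (cases "p \<in> S")
      case True
      then show ?thesis using S ic unfolding double_perm_def by blast
    next
      case False
      then have "snd p = v" using p by auto
      then show ?thesis using v ic by force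
    qed
  qed
qed

text \<open>\<open>X\<close> misses a one of the vertical pair and \<open>Y\<close> a one of the
  horizontal pair, so \<open>X\<close> is a double permutation pattern and \<open>Y\<close> is a
  transposed one. Both remain so when the corner needed for gluing is added.\<close>

lemma lin_horn_split:
  assumes Q: "X \<union> Y \<subseteq> horn k" and XY: "\<And>p q. p \<in> X \<Longrightarrow> q \<in> Y \<Longrightarrow> fst p < fst q \<and> snd p < snd q"
    and X: "X \<noteq> {}" "\<not> {(4 * k + 4, 4 * k + 6), (4 * k + 5, 4 * k + 6)} \<subseteq> X"
    and Y: "\<not> {(0, 2), (0, 3)} \<subseteq> Y"
  shows "lin (X \<union> Y)"
proof -
  have fin: "finite X" "finite Y" using Q finite_horn finite_subset by blast+
  define c where "c = 4 * k + 7"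
  have c: "fst p < c \<and> snd p < c" if "p \<in> X" for p
  proof -
    have "p \<in> horn k" using that Q by blast
    then show ?thesis by (elim horn_cases) (auto simp: c_def)
  qed
  obtain x where x: "x \<in> X" using X(1) by blast
  have o: "0 < fst q \<and> 0 < snd q" if "q \<in> Y" for q using XY[OF x that] by linarith
  show ?thesis
  proof (rule lin_direct_sum[OF XY])
    have "double_perm X" using double_perm_horn[of X k] Q X(2) by blast
    then have "double_perm (insert (c, c) X)"
      by (rule double_perm_insert) (use c in auto)
    then show "lin (insert (c, c) X)" using fin by (intro double_perm_lin) auto
  next
    have "double_perm (prod.swap ` Y)" using double_perm_horn_swap[of Y k] Q Y by blast
    moreover have "0 < fst q \<and> 0 < snd q" if "q \<in> prod.swap ` Y" for q using that o by auto
    ultimately have "double_perm (insert (0, 0) (prod.swap ` Y))"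
      by (intro double_perm_insert) auto
    then have "lin (prod.swap ` insert (0, 0) Y)" using fin by (intro double_perm_lin) auto
    then show "lin (insert (0, 0) Y)" by (rule lin_swap)
  qed (use c o in auto)
qed

section \<open>Nonlinear parts of a horn\<close>

context
  fixes Q k
  assumes Q: "Q \<subseteq> horn k" "\<not> lin Q"
begin

lemma ends_in:
  "{(0, 2), (0, 3), (4 * k + 4, 4 * k + 6), (4 * k + 5, 4 * k + 6)} \<subseteq> Q"
proof -
  have fin: "finite Q" using Q(1) finite_horn finite_subset by blast
  have "{(4 * k + 4, 4 * k + 6), (4 * k + 5, 4 * k + 6)} \<subseteq> Q"
    using double_perm_lin[OF fin] double_perm_horn[OF Q(1)] Q(2) by blast
  moreover have "{(0, 2), (0, 3)} \<subseteq> Q"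
    using double_perm_lin[of "prod.swap ` Q"] fin double_perm_horn_swap[OF Q(1)] Q(2) lin_swap by blast
  ultimately show ?thesis by blast
qed

text \<open>Row 0 is the first row and column \<open>4 * k + 6\<close> the last column. So the
  horizontal pair cannot be in the lower right summand nor the vertical pair in the upper left one,
  and the direct sum would be linear.\<close>

lemma not_direct_sum:
  assumes "Q = X \<union> Y" "X \<noteq> {}" "Y \<noteq> {}" "\<And>p q. p \<in> X \<Longrightarrow> q \<in> Y \<Longrightarrow> fst p < fst q \<and> snd p < snd q"
  shows False
proof -
  obtain x y where xy: "x \<in> X" "y \<in> Y" using assms(2,3) by blast
  have "\<not> {(4 * k + 4, 4 * k + 6), (4 * k + 5, 4 * k + 6)} \<subseteq> X"
  proof
    assume "{(4 * k + 4, 4 * k + 6), (4 * k + 5, 4 * k + 6)} \<subseteq> X"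
    then have "4 * k + 6 < snd y" using assms(4)[OF _ xy(2), of "(4 * k + 4, 4 * k + 6)"] by simp
    moreover have "y \<in> horn k" using Q(1) assms(1) xy by blast
    then have "snd y \<le> 4 * k + 6" by (elim horn_cases) auto
    ultimately show False by simp
  qed
  moreover have "\<not> {(0, 2), (0, 3)} \<subseteq> Y"
  proof
    assume "{(0, 2), (0, 3)} \<subseteq> Y"
    then show False using assms(4)[OF xy(1), of "(0, 2)"] by simp
  qed
  ultimately have "lin (X \<union> Y)" using Q(1) assms by (intro lin_horn_split[of X Y k]) auto
  then show False using Q(2) assms(1) by simp
qed

text \<open>Cut before row \<open>4 * j + 3\<close> and before column \<open>4 * j + 4\<close>: the
  upper right part of \<open>horn k\<close> is empty, and the lower left part contains only the link
  with index \<open>j\<close>. Without it \<open>Q\<close> is a direct sum, with the horizontal pair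
  in one summand and the vertical pair in the other.\<close>

lemma diagonal_in:
  assumes "j \<le> k"
  shows "(4 * j + 6, 4 * j) \<in> Q"
proof (rule ccontr)
  assume b: "(4 * j + 6, 4 * j) \<notin> Q"
  define X where "X = {p\<in>Q. fst p < 4 * j + 3}"
  define Y where "Y = {p\<in>Q. 4 * j + 3 \<le> fst p}"
  show False
  proof (rule not_direct_sum)
    show "Q = X \<union> Y" by (auto simp: X_def Y_def)
    have "(0, 2) \<in> X" using ends_in by (auto simp: X_def)
    then show "X \<noteq> {}" by blast
    have "(4 * k + 4, 4 * k + 6) \<in> Y" using ends_in assms by (auto simp: Y_def)
    then show "Y \<noteq> {}" by blast
    fix p q assume "p \<in> X" "q \<in> Y"
    then have p: "p \<in> horn k" "fst p < 4 * j + 3" and q: "q \<in> horn k" "4 * j + 3 \<le> fst q" "q \<noteq> (4 * j + 6, 4 * j)"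
      using Q(1) b by (auto simp: X_def Y_def)
    have "snd p < 4 * j + 4" using p assms by (elim horn_cases) (simp_all, presburger?)
    moreover have "4 * j + 4 \<le> snd q" using q assms by (elim horn_cases) auto
    ultimately show "fst p < fst q \<and> snd p < snd q" using p q by simp
  qed
qed

lemma card_gt: "k < card Q"
proof -
  have "(\<lambda>j. (4 * j + 6, 4 * j)) ` {..k} \<subseteq> Q" using diagonal_in by blast
  moreover have "finite Q" using Q(1) finite_horn finite_subset by blast
  ultimately have "card ((\<lambda>j. (4 * j + 6, 4 * j)) ` {..k}) \<le> card Q" by (rule card_mono[rotated])
  moreover have "inj_on (\<lambda>j. (4 * j + 6, 4 * j)) {..k}" by (auto simp: inj_on_def)
  ultimately show ?thesis by (simp add: card_image)
qed

end

lemma exists_minimal_nonlin: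
  obtains Q where "Q \<subseteq> horn k" "\<not> lin Q" "\<And>T. T \<subset> Q \<Longrightarrow> lin T"
proof -
  define P where "P T \<longleftrightarrow> T \<subseteq> horn k \<and> \<not> lin T" for T
  have "P (horn k)" using not_lin_horn by (simp add: P_def)
  from ex_has_least_nat[of P, OF this, of card] obtain Q where "P Q" "\<And>T. P T \<Longrightarrow> card Q \<le> card T" by blast
  then have Q: "Q \<subseteq> horn k" "\<not> lin Q" "\<And>T. T \<subseteq> horn k \<Longrightarrow> \<not> lin T \<Longrightarrow> card Q \<le> card T"
    by (simp_all add: P_def)
  have "lin T" if "T \<subset> Q" for T
  proof (rule ccontr)
    assume "\<not> lin T"
    moreover have "T \<subseteq> horn k" using that Q(1) by blast
    ultimately have "card Q \<le> card T" using Q(3) by simp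
    moreover have "finite Q" using Q(1) finite_horn finite_subset by blast
    ultimately show False using psubset_card_mono[of Q T] that by simp
  qed
  then show thesis using that[of Q] Q(1,2) by blast
qed

text \<open>Place \<open>t\<close> copies of \<open>A\<close> along the diagonal. In an embedding of
  \<open>Q\<close>, the ones sent to the first block used come before all others in rows and
  columns; as \<open>Q\<close> is not a direct sum there are no others, and \<open>Q\<close> embeds
  in \<open>A\<close>.\<close>

lemma superadditive:
  assumes ns: "\<And>X Y. \<lbrakk>Q = X \<union> Y; X \<noteq> {}; Y \<noteq> {}; \<And>p q. p \<in> X \<Longrightarrow> q \<in> Y \<Longrightarrow> fst p < fst q \<and> snd p < snd q\<rbrakk> \<Longrightarrow> False"
    and A: "A \<subseteq> {..<m} \<times> {..<m}" "\<not> emb Q A" and Q: "Q \<noteq> {}" "finite Q"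
  shows "\<exists>B\<subseteq>{..<t * m} \<times> {..<t * m}. \<not> emb Q B \<and> card B = t * card A"
proof (intro exI conjI)
  define sh where "sh l p = (fst p + l * m, snd p + l * m)" for l and p :: "nat \<times> nat"
  define B where "B = (\<Union>l<t. sh l ` A)"
  show "B \<subseteq> {..<t * m} \<times> {..<t * m}"
  proof
    fix x assume "x \<in> B"
    then obtain l p where lp: "l < t" "p \<in> A" "x = sh l p" by (auto simp: B_def)
    have "fst p < m" "snd p < m" using lp(2) A(1) by auto
    then have "fst x < Suc l * m" "snd x < Suc l * m" using lp by (auto simp: sh_def)
    moreover have "Suc l * m \<le> t * m" using lp by (intro mult_le_mono1) simp
    ultimately show "x \<in> {..<t * m} \<times> {..<t * m}" by (auto simp: mem_Times_iff)
  qed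
  have blk: "fst x div m = l \<and> snd x div m = l" if "x \<in> sh l ` A" for x l
    using that A(1) by (auto simp: sh_def)
  have same: "fst x div m = snd x div m" "(fst x - fst x div m * m, snd x - fst x div m * m) \<in> A" if "x \<in> B" for x
  proof -
    obtain l where "x \<in> sh l ` A" using \<open>x \<in> B\<close> by (auto simp: B_def)
    moreover from blk[OF this] show "fst x div m = snd x div m" by simp
    ultimately show "(fst x - fst x div m * m, snd x - fst x div m * m) \<in> A"
      using blk[of x l] by (auto simp: sh_def)
  qed
  show "\<not> emb Q B"
  proof
    assume "emb Q B"
    then obtain f g where fg: "\<And>p q. \<lbrakk>p \<in> Q; q \<in> Q; fst p < fst q\<rbrakk> \<Longrightarrow> f (fst p) < f (fst q)"
      "\<And>p q. \<lbrakk>p \<in> Q; q \<in> Q; snd p < snd q\<rbrakk> \<Longrightarrow> g (snd p) < g (snd q)"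
      "\<And>p. p \<in> Q \<Longrightarrow> (f (fst p), g (snd p)) \<in> B" by (rule embE) blast
    define b where "b p = f (fst p) div m" for p :: "nat \<times> nat"
    have b: "b p = g (snd p) div m" "(f (fst p) - b p * m, g (snd p) - b p * m) \<in> A" if "p \<in> Q" for p
      using same[OF fg(3)[OF that]] by (simp_all add: b_def)
    define l where "l = Min (b ` Q)"
    have l: "l \<in> b ` Q" "\<And>p. p \<in> Q \<Longrightarrow> l \<le> b p" using Q by (auto simp: l_def)
    have "b p = l" if "p \<in> Q" for p
    proof (rule ccontr)
      assume "b p \<noteq> l"
      define X where "X = {p\<in>Q. b p = l}"
      define Y where "Y = {p\<in>Q. b p \<noteq> l}"
      have less: "u < v" if "u div m < v div m" for u v :: nat using that by (meson div_le_mono leD leI)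
      have XY: "fst x < fst y \<and> snd x < snd y" if "x \<in> X" "y \<in> Y" for x y
      proof -
        have xy: "x \<in> Q" "y \<in> Q" "b x < b y" using that l(2)[of y] by (auto simp: X_def Y_def)
        then have fxy: "f (fst x) < f (fst y)" "g (snd x) < g (snd y)"
          using b(1)[OF xy(1)] b(1)[OF xy(2)] by (auto intro: less simp: b_def)
        have "\<not> fst y < fst x" "\<not> snd y < snd x"
          using fg(1)[OF xy(2,1)] fg(2)[OF xy(2,1)] fxy by auto
        moreover have "fst x \<noteq> fst y" "snd x \<noteq> snd y" using fxy by auto
        ultimately show ?thesis by linarith
      qed
      have "Q = X \<union> Y" by (auto simp: X_def Y_def)
      moreover have "X \<noteq> {}" using l(1) by (auto simp: X_def)
      moreover have "Y \<noteq> {}" using \<open>p \<in> Q\<close> \<open>b p \<noteq> l\<close> unfolding Y_def by blast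
      ultimately show False using XY by (rule ns)
    qed
    note bl = this
    have "emb Q A"
    proof (rule embI[of Q "\<lambda>i. f i - l * m" "\<lambda>j. g j - l * m"])
      fix p q assume pq: "p \<in> Q" "q \<in> Q"
      have "f (fst p) div m = l" "g (snd p) div m = l" using bl[OF pq(1)] b(1)[OF pq(1)] by (simp_all add: b_def)
      then have "l * m \<le> f (fst p)" "l * m \<le> g (snd p)" by (metis div_times_less_eq_dividend)+
      then show "fst p < fst q \<Longrightarrow> f (fst p) - l * m < f (fst q) - l * m"
        "snd p < snd q \<Longrightarrow> g (snd p) - l * m < g (snd q) - l * m"
        using fg(1)[OF pq] fg(2)[OF pq] by (simp_all add: diff_less_mono)
    next
      fix p assume p: "p \<in> Q"
      show "(f (fst p) - l * m, g (snd p) - l * m) \<in> A" using b(2)[OF p] bl[OF p] by simp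
    qed
    then show False using A(2) by blast
  qed
  have "finite A" using A(1) finite_subset by blast
  moreover have "sh l ` A \<inter> sh l' ` A = {}" if "l \<noteq> l'" for l l'
  proof (rule equals0I)
    fix x assume "x \<in> sh l ` A \<inter> sh l' ` A"
    then show False using blk[of x l] blk[of x l'] that by simp
  qed
  ultimately have "card B = (\<Sum>l<t. card (sh l ` A))"
    unfolding B_def by (intro card_UN_disjoint) auto
  also have "\<dots> = (\<Sum>l<t. card A)"
    by (intro sum.cong refl card_image) (auto simp: inj_on_def sh_def prod_eq_iff)
  finally show "card B = t * card A" by simp
qed

section \<open>From planar patterns to matrices\<close>

lemma positions_Nil [simp]: "positions [] = {[]}"
  by (auto simp: positions_def)

lemma Cons_in_positions [simp]: "a # x \<in> positions (n # ns) \<longleftrightarrow> a < n \<and> x \<in> positions ns"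
  by (simp add: positions_def)

lemma positions_Cons: "positions (n # ns) = (\<lambda>(a, x). a # x) ` ({..<n} \<times> positions ns)"
  by (auto simp: positions_def list_all2_Cons2)

lemma finite_positions: "finite (positions ns)"
  by (induction ns) (simp_all add: positions_Cons)

lemma in_positions_iff: "x \<in> positions ns \<longleftrightarrow> length x = length ns \<and> (\<forall>i<length ns. x ! i < ns ! i)"
  by (auto simp: positions_def list_all2_conv_all_nth)

lemma strict_mono_on_lessThan_ge:
  fixes f :: "nat \<Rightarrow> nat"
  assumes "strict_mono_on {..<n} f" "k < n"
  shows "k \<le> f k"
  using assms(2)
proof (induction k)
  case (Suc k)
  then have "f k < f (Suc k)" using assms(1) by (simp add: strict_mono_on_def)
  then show ?case using Suc by simp
qed simp

text \<open>The lower bound for strictly increasing functions, applied to the reflected function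
  \<open>g\<close>, is the upper bound for \<open>f\<close>. It will show that index maps between
  sides of equal length are identities.\<close>

lemma strict_mono_on_lessThan_id:
  fixes f :: "nat \<Rightarrow> nat"
  assumes "strict_mono_on {..<n} f" "\<And>k. k < n \<Longrightarrow> f k < n" "k < n"
  shows "f k = k"
proof -
  define g where "g k = n - 1 - f (n - 1 - k)" for k
  have "strict_mono_on {..<n} g"
  proof (rule strict_mono_onI)
    fix r s assume rs: "r \<in> {..<n}" "s \<in> {..<n}" "r < s"
    then have "f (n - 1 - s) < f (n - 1 - r)" using assms(1) by (simp add: strict_mono_on_def diff_less_mono2)
    moreover have "f (n - 1 - r) < n" using assms(2) rs by simp
    ultimately show "g r < g s" by (simp add: g_def diff_less_mono2)
  qed
  then have "n - 1 - k \<le> g (n - 1 - k)" using assms(3) by (intro strict_mono_on_lessThan_ge) auto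
  then have "n - 1 - k \<le> n - 1 - f k" using assms(3) by (simp add: g_def)
  then have "f k \<le> k" using assms(2)[OF assms(3)] assms(3) by linarith
  then show ?thesis using strict_mono_on_lessThan_ge[OF assms(1,3)] by simp
qed

lemma sorted_list_of_image_strict_mono:
  fixes f :: "nat \<Rightarrow> nat"
  assumes "strict_mono_on {..<n} f"
  shows "sorted_list_of_set (f ` {..<n}) = map f [0..<n]"
proof (rule strict_sorted_equal)
  show "sorted_wrt (<) (sorted_list_of_set (f ` {..<n}))" by simp
  show "sorted_wrt (<) (map f [0..<n])"
    using assms by (simp add: sorted_wrt_iff_nth_less strict_mono_on_def)
qed auto

text \<open>Sets of retained values correspond to their increasing enumerations \<open>F i\<close>.
  With index maps in place of sets, copies can be restricted, composed and extended.\<close>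

lemma contains_iff:
  assumes "ones P \<subseteq> positions (dims P)"
  shows "contains A P \<longleftrightarrow> length (dims A) = length (dims P) \<and>
    (\<exists>F. (\<forall>i<length (dims P). strict_mono_on {..<dims P ! i} (F i) \<and> (\<forall>k<dims P ! i. F i k < dims A ! i)) \<and>
      (\<forall>x\<in>ones P. map (\<lambda>i. F i (x ! i)) [0..<length (dims P)] \<in> ones A))" (is "_ \<longleftrightarrow> ?R")
proof
  assume "contains A P"
  then obtain S where S: "list_all2 (\<lambda>T k. T \<subseteq> {..<k}) S (dims A)" "map card S = dims P"
    "ones P \<subseteq> ones (submatrix01 A S)"
    unfolding contains_def by (auto simp: submatrix01_def)
  have len: "length S = length (dims A)" "length (dims P) = length S"
    using list_all2_lengthD[OF S(1)] arg_cong[OF S(2), of length] by simp_all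
  define F where "F i k = sorted_list_of_set (S ! i) ! k" for i k
  have F: "strict_mono_on {..<dims P ! i} (F i) \<and> (\<forall>k<dims P ! i. F i k < dims A ! i)" if i: "i < length (dims P)" for i
  proof -
    have Si: "S ! i \<subseteq> {..<dims A ! i}" "dims P ! i = card (S ! i)"
      using S(1) i len S(2)[symmetric] by (simp_all add: list_all2_conv_all_nth)
    have fin: "finite (S ! i)" using Si(1) finite_subset by blast
    have "F i k \<in> S ! i" if "k < dims P ! i" for k
      using that Si fin nth_mem[of k "sorted_list_of_set (S ! i)"] by (simp add: F_def)
    moreover have "strict_mono_on {..<dims P ! i} (F i)"
      using Si fin strict_sorted_list_of_set[of "S ! i"]
      by (auto simp: F_def strict_mono_on_def sorted_wrt_iff_nth_less)
    ultimately show ?thesis using Si(1) by blast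
  qed
  have "map (\<lambda>i. F i (x ! i)) [0..<length (dims P)] \<in> ones A" if x: "x \<in> ones P" for x
  proof -
    have "map2 (\<lambda>T k. sorted_list_of_set T ! k) S x \<in> ones A"
      using x S(3) by (auto simp: submatrix01_def)
    moreover have "map2 (\<lambda>T k. sorted_list_of_set T ! k) S x = map (\<lambda>i. F i (x ! i)) [0..<length (dims P)]"
      using x assms len by (intro nth_equalityI) (auto simp: F_def in_positions_iff)
    ultimately show ?thesis by simp
  qed
  then show ?R using F len by auto
next
  assume ?R
  then obtain F where len: "length (dims A) = length (dims P)"
    and F: "\<And>i. i < length (dims P) \<Longrightarrow> strict_mono_on {..<dims P ! i} (F i)"
      "\<And>i k. i < length (dims P) \<Longrightarrow> k < dims P ! i \<Longrightarrow> F i k < dims A ! i"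
      "\<And>x. x \<in> ones P \<Longrightarrow> map (\<lambda>i. F i (x ! i)) [0..<length (dims P)] \<in> ones A" by blast
  define S where "S = map (\<lambda>i. F i ` {..<dims P ! i}) [0..<length (dims P)]"
  have card: "map card S = dims P"
    by (rule nth_equalityI) (auto simp: S_def card_image strict_mono_on_imp_inj_on F(1))
  have "list_all2 (\<lambda>T k. T \<subseteq> {..<k}) S (dims A)"
    using F(2) len by (auto simp: list_all2_conv_all_nth S_def)
  moreover have "ones P \<subseteq> ones (submatrix01 A S)"
  proof
    fix x assume x: "x \<in> ones P"
    then have pos: "x \<in> positions (dims P)" using assms by blast
    have "map2 (\<lambda>T k. sorted_list_of_set T ! k) S x = map (\<lambda>i. F i (x ! i)) [0..<length (dims P)]"
      using pos by (intro nth_equalityI)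
        (auto simp: S_def in_positions_iff sorted_list_of_image_strict_mono[OF F(1)])
    then show "x \<in> ones (submatrix01 A S)" using F(3)[OF x] pos by (simp add: submatrix01_def card)
  qed
  moreover have "dims (submatrix01 A S) = dims P" by (simp add: submatrix01_def card)
  ultimately show "contains A P" unfolding contains_def by blast
qed

lemma finite_free_matrices: "finite (free_matrices n P d)"
proof (rule finite_subset)
  show "free_matrices n P d \<subseteq> Matrix01 (replicate d n) ` Pow (positions (replicate d n))"
  proof
    fix A assume "A \<in> free_matrices n P d"
    then show "A \<in> Matrix01 (replicate d n) ` Pow (positions (replicate d n))"
      by (cases A) (auto simp: free_matrices_def is_matrix01_def)
  qed
qed (simp add: finite_positions)

lemma ex_upper:
  assumes "\<And>A. A \<in> free_matrices n P d \<Longrightarrow> card (ones A) \<le> b"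
  shows "ex n P d \<le> b"
  using assms finite_free_matrices by (auto simp: ex_def)

lemma ex_lower: "A \<in> free_matrices n P d \<Longrightarrow> card (ones A) \<le> ex n P d"
  using finite_free_matrices by (auto simp: ex_def)

section \<open>Planar point sets as two-dimensional matrices\<close>

abbreviation list2 :: "nat \<times> nat \<Rightarrow> nat list" where "list2 p \<equiv> [fst p, snd p]"

definition matrix2 :: "nat \<Rightarrow> nat \<Rightarrow> (nat \<times> nat) set \<Rightarrow> matrix01" where
  "matrix2 n m A = Matrix01 [n, m] (list2 ` A)"

lemma card_matrix2: "card (ones (matrix2 n m A)) = card A"
  by (simp add: matrix2_def card_image inj_on_def prod_eq_iff)

lemma is_matrix2: "is_matrix01 2 (matrix2 n m A) \<longleftrightarrow> 0 < n \<and> 0 < m \<and> A \<subseteq> {..<n} \<times> {..<m}"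
  by (auto simp: matrix2_def is_matrix01_def image_subset_iff)

lemma is_matrix2_cases:
  assumes "is_matrix01 2 M"
  obtains n m A where "M = matrix2 n m A"
proof -
  obtain n m where nm: "dims M = [n, m]"
    using assms by (auto simp: is_matrix01_def numeral_2_eq_2 length_Suc_conv)
  have "ones M = list2 ` {p. list2 p \<in> ones M}"
  proof (intro set_eqI iffI)
    fix x assume x: "x \<in> ones M"
    then have "length x = 2" using assms nm by (auto simp: is_matrix01_def in_positions_iff)
    then obtain i j where "x = [i, j]" by (auto simp: numeral_2_eq_2 length_Suc_conv)
    then show "x \<in> list2 ` {p. list2 p \<in> ones M}" using x by (intro image_eqI[of _ _ "(i, j)"]) auto
  qed auto
  then have "M = matrix2 n m {p. list2 p \<in> ones M}"
    using nm unfolding matrix2_def by (metis matrix01.collapse)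
  then show thesis by (rule that)
qed

lemma contains_matrix2:
  assumes "S \<subseteq> {..<p} \<times> {..<q}"
  shows "contains (matrix2 n m A) (matrix2 p q S) \<longleftrightarrow>
    (\<exists>f g. strict_mono_on {..<p} f \<and> strict_mono_on {..<q} g \<and> (\<forall>i<p. f i < n) \<and> (\<forall>j<q. g j < m) \<and>
      (\<forall>x\<in>S. (f (fst x), g (snd x)) \<in> A))" (is "?L \<longleftrightarrow> ?R")
proof -
  have pos: "ones (matrix2 p q S) \<subseteq> positions (dims (matrix2 p q S))"
    using assms by (auto simp: matrix2_def image_subset_iff)
  have up: "[0..<2] = [0, 1::nat]" by (simp add: upt_rec)
  have inA: "[a, b] \<in> list2 ` A \<longleftrightarrow> (a, b) \<in> A" for a b by force
  have all2: "(\<forall>i<2. P i) \<longleftrightarrow> P 0 \<and> P (1::nat)" for P by (auto simp: less_2_cases_iff)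
  have "?L \<longleftrightarrow> (\<exists>F. (strict_mono_on {..<p} (F 0) \<and> (\<forall>k<p. F 0 k < n)) \<and>
    (strict_mono_on {..<q} (F (Suc 0)) \<and> (\<forall>k<q. F (Suc 0) k < m)) \<and> (\<forall>x\<in>S. (F 0 (fst x), F (Suc 0) (snd x)) \<in> A))"
    (is "_ \<longleftrightarrow> ?M")
    unfolding contains_iff[OF pos] by (simp add: matrix2_def up inA all2 numeral_2_eq_2[symmetric] del: upt_Suc)
  also have "\<dots> \<longleftrightarrow> ?R"
  proof
    assume ?R
    then obtain f g where "strict_mono_on {..<p} f \<and> strict_mono_on {..<q} g \<and> (\<forall>i<p. f i < n) \<and> (\<forall>j<q. g j < m) \<and>
      (\<forall>x\<in>S. (f (fst x), g (snd x)) \<in> A)" by blast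
    then show ?M by (intro exI[of _ "\<lambda>i::nat. if i = 0 then f else g"]) simp
  qed blast
  finally show ?thesis .
qed

text \<open>Images of different members of \<open>X\<close> are at least \<open>K\<close> apart and
  \<open>p \<le> K\<close>, which leaves room for the other indices: \<open>i\<close> is put
  \<open>i - Max (R i)\<close> places after the image of the last member of \<open>X\<close> up to
  \<open>i\<close>. Indices before all of \<open>X\<close> stay fixed; they are less than
  \<open>K\<close>, which no image of a member of \<open>X\<close> is.\<close>

lemma spread_embedding:
  fixes f :: "nat \<Rightarrow> nat"
  assumes X: "X \<subseteq> {..<p}" "\<And>r s. \<lbrakk>r \<in> X; s \<in> X; r < s\<rbrakk> \<Longrightarrow> f r < f s" and K: "p \<le> K" "K \<le> n"
    and b: "\<And>r. r \<in> X \<Longrightarrow> K \<le> K * f r + \<alpha> \<and> K * f r + \<alpha> + K \<le> n"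
  obtains F where "strict_mono_on {..<p} F" "\<And>i. i < p \<Longrightarrow> F i < n" "\<And>r. r \<in> X \<Longrightarrow> F r = K * f r + \<alpha>"
proof -
  define R where "R i = {r\<in>X. r \<le> i}" for i
  define F where "F i = (if R i = {} then i else K * f (Max (R i)) + \<alpha> + (i - Max (R i)))" for i
  have fin: "finite (R i)" for i by (rule finite_subset[of _ "{..i}"]) (auto simp: R_def)
  have M: "Max (R i) \<in> X" "Max (R i) \<le> i" if "R i \<noteq> {}" for i
    using Max_in[OF fin that] by (auto simp: R_def)
  show thesis
  proof (rule that[of F])
    show "strict_mono_on {..<p} F"
    proof (rule strict_mono_onI)
      fix i j assume ij: "i \<in> {..<p}" "j \<in> {..<p}" "i < j"
      have sub: "R i \<subseteq> R j" using ij by (auto simp: R_def)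
      consider "R j = {}" | "R i = {}" "R j \<noteq> {}" | "R i \<noteq> {}" "R j \<noteq> {}" by blast
      then show "F i < F j"
      proof cases
        case 1
        then show ?thesis using sub ij by (simp add: F_def)
      next
        case 2
        then have "i < K * f (Max (R j)) + \<alpha>" using b[OF M(1)[OF 2(2)]] ij(1) K(1) by simp
        then show ?thesis using 2 by (simp add: F_def)
      next
        case 3
        then have le: "Max (R i) \<le> Max (R j)" using Max_mono[OF sub _ fin] by simp
        show ?thesis
        proof (cases "Max (R i) = Max (R j)")
          case True
          then show ?thesis using 3 ij M(2)[OF 3(1)] by (simp add: F_def)
        next
          case False
          then have "Suc (f (Max (R i))) \<le> f (Max (R j))" using le X(2)[OF M(1)[OF 3(1)] M(1)[OF 3(2)]] by simp
          then have "K * Suc (f (Max (R i))) \<le> K * f (Max (R j))" by (rule mult_le_mono2)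
          then have "K * f (Max (R i)) + K \<le> K * f (Max (R j))" by simp
          moreover have "i < K" using ij(1) K(1) by simp
          ultimately show ?thesis using 3 by (simp add: F_def)
        qed
      qed
    qed
    show "F i < n" if "i < p" for i
    proof (cases "R i = {}")
      case True
      then show ?thesis using that K by (simp add: F_def)
    next
      case False
      have "i - Max (R i) < K" using that K(1) by simp
      moreover have "K * f (Max (R i)) + \<alpha> + K \<le> n" using b[OF M(1)[OF False]] by simp
      ultimately show ?thesis using False by (simp add: F_def)
    qed
    show "F r = K * f r + \<alpha>" if "r \<in> X" for r
    proof -
      have "Max (R r) = r" using that fin by (intro Max_eqI) (auto simp: R_def)
      moreover have "R r \<noteq> {}" using that by (auto simp: R_def)
      ultimately show ?thesis by (simp add: F_def)
    qed
  qed
qed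

text \<open>Empty rows and columns of a pattern do not matter: restrict to the positions in a fixed pair
  of residue classes modulo a large \<open>K\<close>, so that there is room for them between any two ones.\<close>

lemma lin_matrix2_bound:
  assumes S: "S \<subseteq> {..<p} \<times> {..<q}" and lin: "lin S"
  shows "\<exists>C. \<forall>n A. A \<subseteq> {..<n} \<times> {..<n} \<and> \<not> contains (matrix2 n n A) (matrix2 p q S) \<longrightarrow> card A \<le> C * n"
proof -
  obtain C where C: "\<And>n A. A \<subseteq> {..<n} \<times> {..<n} \<Longrightarrow> \<not> emb S A \<Longrightarrow> card A \<le> C * n"
    using lin unfolding lin_def by blast
  define K where "K = p + q + 1"
  have K: "p \<le> K" "q \<le> K" "0 < K" by (simp_all add: K_def)
  have "card A \<le> (4 * K + K * K * C) * n"
    if A: "A \<subseteq> {..<n} \<times> {..<n}" and av: "\<not> contains (matrix2 n n A) (matrix2 p q S)" for n A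
  proof (cases "n < K")
    case True
    have "card A \<le> card ({..<n} \<times> {..<n})" using A by (intro card_mono) auto
    also have "\<dots> \<le> K * n" using True by (simp add: card_cartesian_product)
    also have "\<dots> \<le> (4 * K + K * K * C) * n" by (rule mult_right_mono) simp_all
    finally show ?thesis .
  next
    case False
    \<comment> \<open>Margins of width \<open>K\<close> are set aside, so that empty rows and
      columns outside the range of the ones also find room. They contain at most
      \<open>4 * K * n\<close> ones.\<close>
    define I where "I = {r. K \<le> r \<and> r + K \<le> n}"
    define A0 where "A0 = A \<inter> I \<times> I"
    define B where "B \<alpha> \<beta> = {x. (K * fst x + \<alpha>, K * snd x + \<beta>) \<in> A0}" for \<alpha> \<beta>
    have B: "card (B \<alpha> \<beta>) \<le> C * n" for \<alpha> \<beta>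
    proof (rule C)
      show "B \<alpha> \<beta> \<subseteq> {..<n} \<times> {..<n}"
      proof
        fix x assume "x \<in> B \<alpha> \<beta>"
        then have "K * fst x + \<alpha> < n" "K * snd x + \<beta> < n" using A by (auto simp: B_def A0_def)
        moreover have "fst x \<le> K * fst x" "snd x \<le> K * snd x" using K(3) by simp_all
        ultimately show "x \<in> {..<n} \<times> {..<n}" unfolding mem_Times_iff lessThan_iff by linarith
      qed
      show "\<not> emb S (B \<alpha> \<beta>)"
      proof
        assume "emb S (B \<alpha> \<beta>)"
        then obtain f g where fg: "\<And>p q. \<lbrakk>p \<in> S; q \<in> S; fst p < fst q\<rbrakk> \<Longrightarrow> f (fst p) < f (fst q)"
          "\<And>p q. \<lbrakk>p \<in> S; q \<in> S; snd p < snd q\<rbrakk> \<Longrightarrow> g (snd p) < g (snd q)"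
          "\<And>p. p \<in> S \<Longrightarrow> (f (fst p), g (snd p)) \<in> B \<alpha> \<beta>" by (rule embE) blast
        have mem: "(K * f (fst x) + \<alpha>, K * g (snd x) + \<beta>) \<in> A0" if "x \<in> S" for x
          using fg(3)[OF that] by (simp add: B_def)
        have bnd: "K \<le> K * f (fst x) + \<alpha> \<and> K * f (fst x) + \<alpha> + K \<le> n"
          "K \<le> K * g (snd x) + \<beta> \<and> K * g (snd x) + \<beta> + K \<le> n" if "x \<in> S" for x
          using mem[OF that] by (simp_all add: A0_def I_def)
        have "K \<le> n" using False by simp
        obtain F where F: "strict_mono_on {..<p} F" "\<And>i. i < p \<Longrightarrow> F i < n" "\<And>r. r \<in> fst ` S \<Longrightarrow> F r = K * f r + \<alpha>"
        proof (rule spread_embedding[of "fst ` S" p f K n \<alpha>])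
          show "fst ` S \<subseteq> {..<p}" using S by auto
          show "f r < f s" if "r \<in> fst ` S" "s \<in> fst ` S" "r < s" for r s using that fg(1) by blast
          show "K \<le> K * f r + \<alpha> \<and> K * f r + \<alpha> + K \<le> n" if "r \<in> fst ` S" for r using that bnd(1) by blast
        qed (use K \<open>K \<le> n\<close> in blast)+
        obtain G where G: "strict_mono_on {..<q} G" "\<And>i. i < q \<Longrightarrow> G i < n" "\<And>r. r \<in> snd ` S \<Longrightarrow> G r = K * g r + \<beta>"
        proof (rule spread_embedding[of "snd ` S" q g K n \<beta>])
          show "snd ` S \<subseteq> {..<q}" using S by auto
          show "g r < g s" if "r \<in> snd ` S" "s \<in> snd ` S" "r < s" for r s using that fg(2) by blast
          show "K \<le> K * g r + \<beta> \<and> K * g r + \<beta> + K \<le> n" if "r \<in> snd ` S" for r using that bnd(2) by blast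
        qed (use K \<open>K \<le> n\<close> in blast)+
        have "(F (fst x), G (snd x)) \<in> A" if "x \<in> S" for x
          using mem[OF that] F(3) G(3) that by (simp add: A0_def)
        then show False using av F(1,2) G(1,2) unfolding contains_matrix2[OF S] by blast
      qed
    qed
    have finA: "finite A" using A finite_subset by blast
    have cover: "A0 \<subseteq> (\<Union>ab\<in>{..<K} \<times> {..<K}. (\<lambda>x. (K * fst x + fst ab, K * snd x + snd ab)) ` B (fst ab) (snd ab))"
    proof
      fix x assume x: "x \<in> A0"
      let ?ab = "(fst x mod K, snd x mod K)" and ?y = "(fst x div K, snd x div K)"
      have eq: "x = (K * fst ?y + fst ?ab, K * snd ?y + snd ?ab)" by simp
      then have "?y \<in> B (fst ?ab) (snd ?ab)" using x by (simp add: B_def)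
      then have "x \<in> (\<lambda>y. (K * fst y + fst ?ab, K * snd y + snd ?ab)) ` B (fst ?ab) (snd ?ab)"
        using eq by (rule rev_image_eqI)
      moreover have "?ab \<in> {..<K} \<times> {..<K}" using K(3) by simp
      ultimately show "x \<in> (\<Union>ab\<in>{..<K} \<times> {..<K}. (\<lambda>x. (K * fst x + fst ab, K * snd x + snd ab)) ` B (fst ab) (snd ab))"
        by (rule UN_I[rotated])
    qed
    have finB: "finite (B \<alpha> \<beta>)" for \<alpha> \<beta>
    proof (rule finite_imageD)
      show "finite ((\<lambda>x. (K * fst x + \<alpha>, K * snd x + \<beta>)) ` B \<alpha> \<beta>)"
        by (rule finite_subset[OF _ finA]) (auto simp: B_def A0_def)
      show "inj_on (\<lambda>x. (K * fst x + \<alpha>, K * snd x + \<beta>)) (B \<alpha> \<beta>)"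
        using K(3) by (auto simp: inj_on_def prod_eq_iff)
    qed
    have "card A0 \<le> card (\<Union>ab\<in>{..<K} \<times> {..<K}. (\<lambda>x. (K * fst x + fst ab, K * snd x + snd ab)) ` B (fst ab) (snd ab))"
      using cover finB by (intro card_mono) auto
    also have "\<dots> \<le> (\<Sum>ab\<in>{..<K} \<times> {..<K}. card ((\<lambda>x. (K * fst x + fst ab, K * snd x + snd ab)) ` B (fst ab) (snd ab)))"
      by (rule card_UN_le) simp
    also have "\<dots> \<le> (\<Sum>ab\<in>{..<K} \<times> {..<K}. C * n)"
      by (rule sum_mono) (use B card_image_le[OF finB] le_trans in blast)
    finally have 1: "card A0 \<le> K * K * C * n" by (simp add: card_cartesian_product)
    have "A - A0 \<subseteq> ({..<K} \<union> {n - K..<n}) \<times> {..<n} \<union> {..<n} \<times> ({..<K} \<union> {n - K..<n})"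
      using A by (auto simp: A0_def I_def)
    then have "card (A - A0) \<le> card (({..<K} \<union> {n - K..<n}) \<times> {..<n} \<union> {..<n} \<times> ({..<K} \<union> {n - K..<n}))"
      by (intro card_mono) auto
    also have "\<dots> \<le> card (({..<K} \<union> {n - K..<n}) \<times> {..<n}) + card ({..<n} \<times> ({..<K} \<union> {n - K..<n}))"
      by (rule card_Un_le)
    also have "\<dots> = 2 * (card ({..<K} \<union> {n - K..<n}) * n)" by (simp only: card_cartesian_product card_lessThan) simp
    also have "\<dots> \<le> 2 * (2 * K * n)"
    proof (intro mult_left_mono mult_right_mono)
      show "card ({..<K} \<union> {n - K..<n}) \<le> 2 * K"
        using card_Un_le[of "{..<K}" "{n - K..<n}"] False by simp
    qed simp_all
    finally have 2: "card (A - A0) \<le> 4 * K * n" by simp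
    have "card A = card (A - A0) + card A0"
      using finA card_mono[of A A0] by (simp add: card_Diff_subset A0_def)
    then show ?thesis using 1 2 by (simp add: algebra_simps)
  qed
  then show ?thesis by blast
qed

lemma free_matrices_2:
  assumes "0 < n" "A \<subseteq> {..<n} \<times> {..<n}"
  shows "matrix2 n n A \<in> free_matrices n P 2 \<longleftrightarrow> \<not> contains (matrix2 n n A) P"
  using assms is_matrix2[of n n A] by (auto simp: free_matrices_def avoids_def matrix2_def numeral_2_eq_2)

lemma lin_imp_bigo:
  assumes S: "S \<subseteq> {..<p} \<times> {..<q}" and lin: "lin S"
  shows "(\<lambda>n. real (ex n (matrix2 p q S) 2)) \<in> O(\<lambda>n. real n)"
proof -
  obtain C where C: "\<And>n A. A \<subseteq> {..<n} \<times> {..<n} \<Longrightarrow> \<not> contains (matrix2 n n A) (matrix2 p q S) \<Longrightarrow> card A \<le> C * n"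
    using lin_matrix2_bound[OF S lin] by blast
  have "ex n (matrix2 p q S) 2 \<le> C * n" for n
  proof (rule ex_upper)
    fix M assume M: "M \<in> free_matrices n (matrix2 p q S) 2"
    then have M2: "is_matrix01 2 M" by (simp add: free_matrices_def)
    then obtain a b A where A: "M = matrix2 a b A" by (rule is_matrix2_cases)
    then have ab: "a = n" "b = n" using M by (auto simp: free_matrices_def matrix2_def numeral_2_eq_2)
    have "A \<subseteq> {..<n} \<times> {..<n}" "0 < n" using M2 is_matrix2[of a b A] A ab by simp_all
    then have "card A \<le> C * n" using C free_matrices_2 M A ab by blast
    then show "card (ones M) \<le> C * n" by (simp add: A card_matrix2)
  qed
  then have "real (ex n (matrix2 p q S) 2) \<le> real C * real n" for n
    by (metis of_nat_le_iff of_nat_mult)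
  then show ?thesis by (intro bigoI[of _ "real C"]) (auto intro: always_eventually)
qed

text \<open>Deletes the empty rows and columns of \<open>Q\<close>. They do not influence linearity,
  but a matrix with an empty row properly contains the one without it, so only the compressed
  pattern can be minimal for containment of matrices.\<close>

lemma compress:
  assumes Q: "finite Q"
  obtains Q' h where "Q' \<subseteq> {..<card (fst ` Q)} \<times> {..<card (snd ` Q)}" "fst ` Q' = {..<card (fst ` Q)}"
    "snd ` Q' = {..<card (snd ` Q)}" "h ` Q' = Q" "inj_on h Q'" "\<forall>T\<subseteq>Q'. emb T (h ` T)" "emb Q Q'"
proof -
  define p where "p = card (fst ` Q)"
  define q where "q = card (snd ` Q)"
  have enum: "\<exists>e. strict_mono_on {..<card X} e \<and> e ` {..<card X} = X" if fin: "finite X" for X :: "nat set"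
  proof -
    obtain e where e: "strict_mono_on {..<card X} e" "\<And>i. i < card X \<Longrightarrow> e i \<in> X"
      using strict_mono_enumeration[OF fin order_refl] by blast
    have "e ` {..<card X} = X"
      using e that by (intro card_subset_eq) (auto simp: card_image strict_mono_on_imp_inj_on)
    then show ?thesis using e by blast
  qed
  obtain e where e: "strict_mono_on {..<p} e" "e ` {..<p} = fst ` Q" using enum[of "fst ` Q"] Q by (auto simp: p_def)
  obtain e' where e': "strict_mono_on {..<q} e'" "e' ` {..<q} = snd ` Q" using enum[of "snd ` Q"] Q by (auto simp: q_def)
  note inj = strict_mono_on_imp_inj_on[OF e(1)] strict_mono_on_imp_inj_on[OF e'(1)]
  define h where "h x = (e (fst x), e' (snd x))" for x
  have inj_h: "inj_on h ({..<p} \<times> {..<q})"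
    using inj by (auto simp: h_def inj_on_def prod_eq_iff)
  define Q' where "Q' = {x \<in> {..<p} \<times> {..<q}. h x \<in> Q}"
  have Q'_sub: "Q' \<subseteq> {..<p} \<times> {..<q}" by (auto simp: Q'_def)
  have hQ': "h ` Q' = Q"
  proof (intro equalityI subsetI)
    fix y assume y: "y \<in> Q"
    then have "fst y \<in> e ` {..<p}" "snd y \<in> e' ` {..<q}" using e(2) e'(2) by auto
    then obtain i j where "i < p" "j < q" "fst y = e i" "snd y = e' j" by auto
    moreover from this have "h (i, j) = y" by (simp add: h_def prod_eq_iff)
    ultimately show "y \<in> h ` Q'" using y by (intro image_eqI[of _ _ "(i, j)"]) (simp_all add: Q'_def)
  qed (auto simp: Q'_def)
  have inj_hQ: "inj_on h Q'" using inj_h Q'_sub inj_on_subset by blast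
  have fstQ': "fst ` Q' = {..<p}"
  proof (intro equalityI subsetI)
    fix i assume i: "i \<in> {..<p}"
    then have "e i \<in> fst ` h ` Q'" using e(2) hQ' by blast
    then obtain x where "x \<in> Q'" "e i = e (fst x)" by (auto simp: h_def)
    then show "i \<in> fst ` Q'" using i Q'_sub inj(1) by (force simp: inj_on_def)
  qed (use Q'_sub in auto)
  have sndQ': "snd ` Q' = {..<q}"
  proof (intro equalityI subsetI)
    fix i assume i: "i \<in> {..<q}"
    then have "e' i \<in> snd ` h ` Q'" using e'(2) hQ' by blast
    then obtain x where "x \<in> Q'" "e' i = e' (snd x)" by (auto simp: h_def)
    then show "i \<in> snd ` Q'" using i Q'_sub inj(2) by (force simp: inj_on_def)
  qed (use Q'_sub in auto)
  have emb_h: "emb T (h ` T)" if "T \<subseteq> Q'" for T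
  proof (rule embI[of T e e'])
    fix x y assume "x \<in> T" "y \<in> T"
    then have "fst x < p" "fst y < p" "snd x < q" "snd y < q" using that Q'_sub by auto
    then show "fst x < fst y \<Longrightarrow> e (fst x) < e (fst y)" "snd x < snd y \<Longrightarrow> e' (snd x) < e' (snd y)"
      using e(1) e'(1) by (simp_all add: strict_mono_on_def)
  qed (simp add: h_def)
  have emb_Q: "emb Q Q'"
  proof -
    define f where "f = inv_into {..<p} e"
    define g where "g = inv_into {..<q} e'"
    have fg: "f (e i) = i" "g (e' j) = j" if "i < p" "j < q" for i j
      using that inj by (simp_all add: f_def g_def)
    have less_e: "i < j" if "e i < e j" "i < p" "j < p" for i j
      using that e(1) unfolding strict_mono_on_def
      by (metis lessThan_iff linorder_neqE_nat order.asym)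
    have less_e': "i < j" if "e' i < e' j" "i < q" "j < q" for i j
      using that e'(1) unfolding strict_mono_on_def
      by (metis lessThan_iff linorder_neqE_nat order.asym)
    show ?thesis
    proof (rule embI[of Q f g])
      fix x y assume "x \<in> Q" "y \<in> Q"
      then obtain x' y' where "x' \<in> Q'" "y' \<in> Q'" "x = h x'" "y = h y'" using hQ' by blast
      moreover from this have "fst x' < p" "snd x' < q" "fst y' < p" "snd y' < q" using Q'_sub by auto
      ultimately show "fst x < fst y \<Longrightarrow> f (fst x) < f (fst y)" "snd x < snd y \<Longrightarrow> g (snd x) < g (snd y)"
        using less_e[of "fst x'" "fst y'"] less_e'[of "snd x'" "snd y'"] by (simp_all add: h_def fg)
    next
      fix x assume "x \<in> Q"
      then obtain x' where "x' \<in> Q'" "x = h x'" using hQ' by blast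
      moreover from this have "fst x' < p" "snd x' < q" using Q'_sub by auto
      ultimately show "(f (fst x), g (snd x)) \<in> Q'" by (simp add: h_def fg)
    qed
  qed
  have "\<forall>T\<subseteq>Q'. emb T (h ` T)" using emb_h by blast
  with Q'_sub fstQ' sndQ' hQ' inj_hQ show thesis using emb_Q unfolding p_def q_def by (rule that)
qed

text \<open>A single \<open>A\<close> with many ones gives, by \<open>superadditive\<close>,
  matrices of all larger sizes, hence \<omega>. The ones of a matrix properly contained in
  \<open>M\<close> go to a proper subset of \<open>Q'\<close>, which is linear by the minimality of
  \<open>Q\<close>.\<close>

lemma minimal_imp_minimally_non_O:
  assumes Q: "finite Q" "\<not> lin Q" "\<And>T. T \<subset> Q \<Longrightarrow> lin T"
    and ns: "\<And>X Y. \<lbrakk>Q = X \<union> Y; X \<noteq> {}; Y \<noteq> {}; \<And>p q. p \<in> X \<Longrightarrow> q \<in> Y \<Longrightarrow> fst p < fst q \<and> snd p < snd q\<rbrakk> \<Longrightarrow> False"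
  obtains M where "minimally_non_O 2 M" "card (ones M) = card Q" "dims M = [card (fst ` Q), card (snd ` Q)]"
proof -
  have Q0: "Q \<noteq> {}"
  proof
    assume "Q = {}"
    then have "emb Q A" for A by (simp add: emb_def)
    then show False using Q(2) by (simp add: lin_def)
  qed
  define p where "p = card (fst ` Q)"
  define q where "q = card (snd ` Q)"
  have pq: "0 < p" "0 < q" using Q(1) Q0 by (simp_all add: p_def q_def card_gt_0_iff)
  obtain Q' h where Q'_sub: "Q' \<subseteq> {..<p} \<times> {..<q}" and fstQ': "fst ` Q' = {..<p}" and sndQ': "snd ` Q' = {..<q}"
    and hQ': "h ` Q' = Q" and inj_hQ: "inj_on h Q'" and emb_h: "\<forall>T\<subseteq>Q'. emb T (h ` T)" and emb_Q: "emb Q Q'"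
    unfolding p_def q_def by (rule compress[OF Q(1)])
  define M where "M = matrix2 p q Q'"
  have "is_matrix01 2 M" using pq Q'_sub is_matrix2 by (simp add: M_def)
  moreover have "(\<lambda>n. real (ex n M 2)) \<in> \<omega>(\<lambda>n. real n ^ (2 - 1))"
  proof (rule landau_omega.smallI)
    fix c :: real assume "0 < c"
    \<comment> \<open>The factor 2 pays for rounding \<open>n\<close> down to the multiple
      \<open>t * m\<close> of \<open>m\<close>, which is at least \<open>n / 2\<close>.\<close>
    define C where "C = nat \<lceil>2 * c\<rceil>"
    have C: "2 * c \<le> real C" by (simp add: C_def real_nat_ceiling_ge)
    have "\<exists>m. \<exists>A\<subseteq>{..<m} \<times> {..<m}. \<not> emb Q A \<and> C * m < card A" using Q(2) by (auto simp: lin_def not_le)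
    then obtain m A where A: "A \<subseteq> {..<m} \<times> {..<m}" "\<not> emb Q A" "C * m < card A" by blast
    have m: "0 < m"
    proof (rule ccontr)
      assume "\<not> 0 < m"
      then have "A = {}" using A(1) by auto
      then show False using A(3) by simp
    qed
    have "c * real n \<le> real (ex n M 2)" if n: "m \<le> n" for n
    proof -
      define t where "t = n div m"
      have t: "t * m \<le> n" by (simp add: t_def)
      have "1 \<le> t" using n m by (simp add: t_def div_greater_zero_iff Suc_leI)
      moreover have "n < t * m + m"
        using div_mult_mod_eq[of n m] mod_less_divisor[OF m, of n] unfolding t_def by linarith
      ultimately have "n \<le> 2 * (t * m)" using mult_le_mono1[of 1 t m] by linarith
      obtain B where B: "B \<subseteq> {..<t * m} \<times> {..<t * m}" "\<not> emb Q B" "card B = t * card A"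
      proof -
        have "\<exists>B\<subseteq>{..<t * m} \<times> {..<t * m}. \<not> emb Q B \<and> card B = t * card A"
          by (rule superadditive[OF _ A(1,2) Q0 Q(1)]) (rule ns)
        then show thesis using that by blast
      qed
      have Bn: "B \<subseteq> {..<n} \<times> {..<n}" using B(1) t by fastforce
      have "\<not> contains (matrix2 n n B) M"
      proof
        assume "contains (matrix2 n n B) M"
        then obtain f g where fg: "strict_mono_on {..<p} f" "strict_mono_on {..<q} g"
          "\<And>x. x \<in> Q' \<Longrightarrow> (f (fst x), g (snd x)) \<in> B"
          unfolding M_def contains_matrix2[OF Q'_sub] by blast
        have "emb Q' B"
          unfolding emb_def using fg by (intro exI[of _ f] exI[of _ g]) (simp add: fstQ' sndQ')
        then show False using emb_trans[OF emb_Q] B(2) by blast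
      qed
      then have "matrix2 n n B \<in> free_matrices n M 2" using free_matrices_2[OF _ Bn] n m by simp
      from ex_lower[OF this] have "t * card A \<le> ex n M 2" by (simp add: card_matrix2 B(3))
      moreover have "t * (C * m) \<le> t * card A" using A(3) by (intro mult_le_mono2) simp
      ultimately have "t * (C * m) \<le> ex n M 2" by (rule le_trans[rotated])
      then have "C * (t * m) \<le> ex n M 2" by (simp only: mult.left_commute)
      then have 1: "real C * real (t * m) \<le> real (ex n M 2)" by (metis of_nat_le_iff of_nat_mult)
      have "real n \<le> 2 * real (t * m)" using \<open>n \<le> 2 * (t * m)\<close> by linarith
      then have "c * real n \<le> c * (2 * real (t * m))" using \<open>0 < c\<close> by (intro mult_left_mono) auto
      also have "\<dots> = (2 * c) * real (t * m)" by simp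
      also have "\<dots> \<le> real C * real (t * m)" using C by (intro mult_right_mono) auto
      finally show ?thesis using 1 by linarith
    qed
    then show "\<forall>\<^sub>F n in at_top. c * norm (real n ^ (2 - 1)) \<le> norm (real (ex n M 2))"
      by (auto simp: eventually_at_top_linorder)
  qed
  moreover have "(\<lambda>n. real (ex n P' 2)) \<in> O(\<lambda>n. real n ^ (2 - 1))"
    if P': "is_matrix01 2 P'" "properly_contained P' M" for P'
  proof -
    obtain a b S where P'_eq: "P' = matrix2 a b S" using is_matrix2_cases[OF P'(1)] by blast
    then have S: "S \<subseteq> {..<a} \<times> {..<b}" using P'(1) is_matrix2 by blast
    have "contains M P'" "P' \<noteq> M" using P'(2) by (auto simp: properly_contained_def)
    then obtain f g where fg: "strict_mono_on {..<a} f" "strict_mono_on {..<b} g"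
      "\<And>i. i < a \<Longrightarrow> f i < p" "\<And>j. j < b \<Longrightarrow> g j < q" "\<And>x. x \<in> S \<Longrightarrow> (f (fst x), g (snd x)) \<in> Q'"
      unfolding P'_eq M_def contains_matrix2[OF S] by blast
    define T where "T = (\<lambda>x. (f (fst x), g (snd x))) ` S"
    have TQ: "T \<subseteq> Q'" using fg(5) by (auto simp: T_def)
    \<comment> \<open>\<open>Q'\<close> has no empty rows or columns. If \<open>T\<close> is all of
      it, \<open>f\<close> and \<open>g\<close> are increasing bijections between initial segments,
      thus identities, and \<open>P' = M\<close>.\<close>
    have "T \<noteq> Q'"
    proof
      assume TQ': "T = Q'"
      have "f ` fst ` S = {..<p}" "g ` snd ` S = {..<q}"
        unfolding fstQ'[symmetric] sndQ'[symmetric] TQ'[symmetric] by (simp_all add: T_def image_image)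
      moreover have "fst ` S \<subseteq> {..<a}" "snd ` S \<subseteq> {..<b}" using S by auto
      ultimately have "{..<p} \<subseteq> f ` {..<a}" "{..<q} \<subseteq> g ` {..<b}" by blast+
      then have "card {..<p} \<le> card (f ` {..<a})" "card {..<q} \<le> card (g ` {..<b})"
        by (intro card_mono; simp)+
      then have "p \<le> a" "q \<le> b" using card_image_le[of "{..<a}" f] card_image_le[of "{..<b}" g] by simp_all
      moreover have "card (f ` {..<a}) \<le> card {..<p}" "card (g ` {..<b}) \<le> card {..<q}"
        using fg(3,4) by (intro card_mono; auto)+
      then have "a \<le> p" "b \<le> q"
        using fg(1,2) by (simp_all add: card_image strict_mono_on_imp_inj_on)
      ultimately have ab: "a = p" "b = q" by simp_all
      have "f i = i" if "i < a" for i using strict_mono_on_lessThan_id[OF fg(1)] fg(3) ab that by simp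
      moreover have "g j = j" if "j < b" for j using strict_mono_on_lessThan_id[OF fg(2)] fg(4) ab that by simp
      ultimately have "(f (fst x), g (snd x)) = x" if "x \<in> S" for x using S that by auto
      then have "T = S" unfolding T_def by simp
      then show False using \<open>P' \<noteq> M\<close> TQ' ab by (simp add: P'_eq M_def)
    qed
    then have "h ` T \<noteq> h ` Q'" using inj_on_image_eq_iff[OF inj_hQ TQ order_refl] by simp
    moreover have "h ` T \<subseteq> h ` Q'" using TQ by (rule image_mono)
    ultimately have "h ` T \<subset> Q" unfolding hQ' by (rule psubsetI[rotated])
    then have "lin (h ` T)" by (rule Q(3))
    moreover have "emb S T"
    proof (rule embI[of S f g])
      fix x y assume "x \<in> S" "y \<in> S"
      then have "fst x < a" "fst y < a" "snd x < b" "snd y < b" using S by auto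
      then show "fst x < fst y \<Longrightarrow> f (fst x) < f (fst y)" "snd x < snd y \<Longrightarrow> g (snd x) < g (snd y)"
        using fg(1,2) by (simp_all add: strict_mono_on_def)
    qed (simp add: T_def)
    ultimately have "lin S" using emb_trans[OF _ emb_h[rule_format, OF TQ]] lin_emb by blast
    then show ?thesis using lin_imp_bigo[OF S] by (simp add: P'_eq)
  qed
  ultimately have "minimally_non_O 2 M" unfolding minimally_non_O_def by blast
  moreover have "card (ones M) = card Q" using card_image[OF inj_hQ] hQ' by (simp add: M_def card_matrix2)
  moreover have "dims M = [card (fst ` Q), card (snd ` Q)]" by (simp add: M_def matrix2_def p_def q_def)
  ultimately show thesis by (rule that)
qed

text \<open>For each \<open>k\<close> there is a minimal matrix with more than \<open>k\<close>
  ones; the horizontal and the vertical pair provide two rows and two columns. The bound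
  \<open>1 < card (ones P)\<close> is carried along because in the step to the next dimension a one
  must stay behind in the lower layer when another is raised.\<close>

lemma infinite_minimally_non_O_2:
  "infinite {P. minimally_non_O 2 P \<and> (\<forall>k\<in>set (dims P). k > 1) \<and> 1 < card (ones P)}"
proof
  assume "finite {P. minimally_non_O 2 P \<and> (\<forall>k\<in>set (dims P). k > 1) \<and> 1 < card (ones P)}" (is "finite ?A")
  define k where "k = Suc (Max (insert 0 ((\<lambda>P. card (ones P)) ` ?A)))"
  obtain Q where Q: "Q \<subseteq> horn k" "\<not> lin Q" "\<And>T. T \<subset> Q \<Longrightarrow> lin T" using exists_minimal_nonlin by blast
  have finQ: "finite Q" using Q(1) finite_horn finite_subset by blast
  obtain M where M: "minimally_non_O 2 M" "card (ones M) = card Q" "dims M = [card (fst ` Q), card (snd ` Q)]"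
  proof (rule minimal_imp_minimally_non_O[OF finQ Q(2,3)])
    fix X Y
    assume "Q = X \<union> Y" "X \<noteq> {}" "Y \<noteq> {}" "\<And>p q. p \<in> X \<Longrightarrow> q \<in> Y \<Longrightarrow> fst p < fst q \<and> snd p < snd q"
    then show False by (rule not_direct_sum[OF Q(1,2)])
  qed
  have "{0, 4 * k + 4} \<subseteq> fst ` Q" "{2, 3} \<subseteq> snd ` Q" using ends_in[OF Q(1,2)] by force+
  then have "card {0, 4 * k + 4} \<le> card (fst ` Q)" "card {2, 3 :: nat} \<le> card (snd ` Q)"
    using finQ by (intro card_mono; simp)+
  then have "\<forall>k\<in>set (dims M). k > 1" by (simp add: M(3))
  moreover have gt: "k < card (ones M)" using card_gt[OF Q(1,2)] M(2) by simp
  ultimately have "M \<in> ?A" using M(1) by (simp add: k_def)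
  then have "card (ones M) \<le> Max (insert 0 ((\<lambda>P. card (ones P)) ` ?A))" using \<open>finite ?A\<close> by (intro Max_ge) auto
  then show False using gt by (simp add: k_def)
qed

section \<open>Raising the dimension\<close>

definition raise :: "nat list \<Rightarrow> matrix01 \<Rightarrow> matrix01" where
  "raise e P = Matrix01 (2 # dims P) (insert (1 # e) ((\<lambda>x. 0 # x) ` (ones P - {e})))"

definition project :: "matrix01 \<Rightarrow> matrix01" where
  "project P = Matrix01 (tl (dims P)) (tl ` ones P)"

lemma is_matrix01_Suc:
  assumes "is_matrix01 (Suc d) P"
  obtains k ks where "dims P = k # ks" "length ks = d" "0 < k" "\<forall>k\<in>set ks. 0 < k"
    "\<And>x. x \<in> ones P \<Longrightarrow> \<exists>a y. x = a # y \<and> a < k \<and> y \<in> positions ks"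
proof -
  obtain k ks where k: "dims P = k # ks" "length ks = d"
    using assms by (auto simp: is_matrix01_def length_Suc_conv)
  show thesis
    by (rule that[OF k]) (use assms k in \<open>auto simp: is_matrix01_def positions_Cons\<close>)
qed

lemma is_matrix01_project:
  assumes "is_matrix01 (Suc d) P"
  shows "is_matrix01 d (project P)"
  using assms by (rule is_matrix01_Suc) (force simp: is_matrix01_def project_def)

lemma contains_project_raise:
  assumes "contains A (raise e P)" "dims A = n # ns" "is_matrix01 d P" "e \<in> ones P"
  shows "contains (project A) P"
proof -
  have P: "ones P \<subseteq> positions (dims P)" using assms(3) by (simp add: is_matrix01_def)
  have R: "ones (raise e P) \<subseteq> positions (dims (raise e P))"
    using P assms(4) by (auto simp: raise_def)
  obtain F where len: "length (dims A) = length (dims (raise e P))"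
    and F: "\<And>i. i < length (dims (raise e P)) \<Longrightarrow> strict_mono_on {..<dims (raise e P) ! i} (F i)"
      "\<And>i k. i < length (dims (raise e P)) \<Longrightarrow> k < dims (raise e P) ! i \<Longrightarrow> F i k < dims A ! i"
      "\<And>x. x \<in> ones (raise e P) \<Longrightarrow> map (\<lambda>i. F i (x ! i)) [0..<length (dims (raise e P))] \<in> ones A"
    using assms(1) unfolding contains_iff[OF R] by blast
  have len_r: "length (dims (raise e P)) = Suc (length (dims P))" by (simp add: raise_def)
  show ?thesis
    unfolding contains_iff[OF P]
  proof (intro conjI exI[of _ "\<lambda>i. F (Suc i)"] allI impI ballI)
    show "length (dims (project A)) = length (dims P)" using len assms(2) len_r by (simp add: project_def)
    fix i assume "i < length (dims P)"
    then show "strict_mono_on {..<dims P ! i} (F (Suc i))"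
      using F(1)[of "Suc i"] by (simp add: raise_def)
    show "F (Suc i) k < dims (project A) ! i" if "k < dims P ! i" for k
      using F(2)[of "Suc i" k] \<open>i < length (dims P)\<close> that assms(2) by (simp add: raise_def project_def)
  next
    fix x assume x: "x \<in> ones P"
    obtain a where "a # x \<in> ones (raise e P)"
      using x by (cases "x = e") (auto simp: raise_def)
    from F(3)[OF this] have "F 0 a # map (\<lambda>i. F (Suc i) (x ! i)) [0..<length (dims P)] \<in> ones A"
      by (simp add: len_r upt_conv_Cons map_Suc_upt[symmetric] comp_def del: upt_Suc)
    then show "map (\<lambda>i. F (Suc i) (x ! i)) [0..<length (dims P)] \<in> ones (project A)"
      by (force simp: project_def)
  qed
qed

text \<open>In the stack of \<open>n\<close> copies of an extremal \<open>A\<close>, a copy of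
  \<open>raise e P\<close> would project to a copy of \<open>P\<close> in \<open>A\<close>.\<close>

lemma ex_raise_ge:
  assumes "is_matrix01 d P" "e \<in> ones P"
  shows "n * ex n P d \<le> ex n (raise e P) (Suc d)"
proof (cases "free_matrices n P d = {}")
  case True
  then show ?thesis by (simp add: ex_def)
next
  case False
  have "Max ((\<lambda>A. card (ones A)) ` free_matrices n P d) \<in> (\<lambda>A. card (ones A)) ` free_matrices n P d"
    using False finite_free_matrices by (intro Max_in) auto
  then obtain A where A: "A \<in> free_matrices n P d" "ex n P d = card (ones A)"
    using False by (auto simp: ex_def)
  show ?thesis
  proof (cases "n = 0")
    case True
    then show ?thesis by simp
  next
    case n: False
    define B where "B = Matrix01 (n # dims A) ((\<lambda>(a, x). a # x) ` ({..<n} \<times> ones A))"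
    have "is_matrix01 d A" and dA: "dims A = replicate d n" and av: "\<not> contains A P"
      using A(1) by (auto simp: free_matrices_def avoids_def)
    then have "is_matrix01 (Suc d) B" using n by (auto simp: is_matrix01_def B_def)
    moreover have "project B = A"
    proof -
      have "tl ` ones B = ones A" using n by (force simp: B_def)
      then show ?thesis by (cases A) (simp add: project_def B_def)
    qed
    then have "\<not> contains B (raise e P)" using contains_project_raise[of B e P n "dims A" d] assms av by (auto simp: B_def)
    ultimately have "B \<in> free_matrices n (raise e P) (Suc d)"
      using dA by (simp add: free_matrices_def avoids_def B_def)
    then have "card (ones B) \<le> ex n (raise e P) (Suc d)" by (rule ex_lower)
    moreover have "card (ones B) = n * card (ones A)"
      unfolding B_def matrix01.sel by (subst card_image) (auto simp: inj_on_def card_cartesian_product)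
    ultimately show ?thesis using A(2) by simp
  qed
qed

text \<open>Delete from a matrix avoiding \<open>P\<close> the last one of every line in the first direction. The
  ones that remain in any layer avoid the projection of \<open>P\<close>: above each of them there is another
  one of the matrix, which can play the role of the single one in the upper layer of \<open>P\<close>.\<close>

lemma ex_project_le:
  assumes P: "is_matrix01 (Suc d) P" and k2: "hd (dims P) \<le> 2"
    and top: "\<And>a b x y. \<lbrakk>a # x \<in> ones P; b # y \<in> ones P; 0 < a; 0 < b\<rbrakk> \<Longrightarrow> x = y"
  shows "ex n P (Suc d) \<le> n ^ d + n * ex n (project P) d"
proof (rule ex_upper)
  fix A assume A: "A \<in> free_matrices n P (Suc d)"
  obtain k ks where k: "dims P = k # ks" "length ks = d" "\<And>x. x \<in> ones P \<Longrightarrow> \<exists>a y. x = a # y \<and> a < k \<and> y \<in> positions ks"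
    using P by (rule is_matrix01_Suc) blast
  have k_le: "k \<le> 2" using k2 k(1) by simp
  have mA: "is_matrix01 (Suc d) A" and dA: "dims A = n # replicate d n" and av: "\<not> contains A P"
    using A by (auto simp: free_matrices_def avoids_def)
  have n: "0 < n" using mA dA by (simp add: is_matrix01_def)
  have oA: "ones A \<subseteq> positions (n # replicate d n)" using mA dA by (simp add: is_matrix01_def)
  define L where "L h = {x. h # x \<in> ones A \<and> (\<exists>h'. h < h' \<and> h' # x \<in> ones A)}" for h
  have L: "card (L h) \<le> ex n (project P) d" if h: "Suc h < n" for h
  proof -
    define M where "M = Matrix01 (replicate d n) (L h)"
    have pP: "ones (project P) \<subseteq> positions (dims (project P))"
      using is_matrix01_project[OF P] by (simp add: is_matrix01_def)
    have dP: "dims (project P) = ks" by (simp add: project_def k(1))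
    have "is_matrix01 d M" using n oA by (auto simp: is_matrix01_def M_def L_def)
    moreover have "\<not> contains M (project P)"
    proof
      assume "contains M (project P)"
      then obtain F where F: "\<And>i. i < d \<Longrightarrow> strict_mono_on {..<ks ! i} (F i)"
          "\<And>i j. i < d \<Longrightarrow> j < ks ! i \<Longrightarrow> F i j < n"
          "\<And>x. x \<in> ones (project P) \<Longrightarrow> map (\<lambda>i. F i (x ! i)) [0..<d] \<in> L h"
        unfolding contains_iff[OF pP] dP by (auto simp: M_def k(2))
      define e where "e x = map (\<lambda>i. F i (x ! i)) [0..<d]" for x
      have "\<exists>h'. h < h' \<and> h' < n \<and> (\<forall>a y. a # y \<in> ones P \<and> 0 < a \<longrightarrow> h' # e y \<in> ones A)"
      proof (cases "\<exists>a y. a # y \<in> ones P \<and> 0 < a")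
        case True
        then obtain a y where ay: "a # y \<in> ones P" "0 < a" by blast
        then have "y \<in> ones (project P)" by (force simp: project_def)
        then have "e y \<in> L h" using F(3) by (simp add: e_def)
        then obtain h' where "h < h'" "h' # e y \<in> ones A" by (auto simp: L_def)
        moreover from this have "h' < n" using oA by auto
        ultimately show ?thesis using top[OF _ ay(1) _ ay(2)] by blast
      next
        case False
        \<comment> \<open>\<open>P\<close> may have no one above layer 0, but an upper layer still
          needs an image; \<open>Suc h < n\<close> guarantees one.\<close>
        then show ?thesis using h by (intro exI[of _ "Suc h"]) auto
      qed
      then obtain h' where h': "h < h'" "h' < n" "\<And>a y. a # y \<in> ones P \<Longrightarrow> 0 < a \<Longrightarrow> h' # e y \<in> ones A" by blast
      define G where "G i = (if i = 0 then (\<lambda>j. if j = 0 then h else h') else F (i - 1))" for i :: nat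
      have "contains A P"
      proof (subst contains_iff)
        show "ones P \<subseteq> positions (dims P)" using P by (simp add: is_matrix01_def)
        have G: "strict_mono_on {..<dims P ! i} (G i) \<and> (\<forall>j<dims P ! i. G i j < dims A ! i)" if i: "i < Suc d" for i
        proof (cases i)
          case 0
          have "strict_mono_on {..<k} (G 0)" using k_le h' by (auto simp: strict_mono_on_def G_def)
          then show ?thesis using 0 h' k(1) dA by (simp add: G_def)
        next
          case (Suc j)
          then show ?thesis using F(1,2)[of j] i k(1) dA by (simp add: G_def)
        qed
        have "map (\<lambda>i. G i (x ! i)) [0..<Suc d] \<in> ones A" if xP: "x \<in> ones P" for x
        proof -
          obtain a y where x: "x = a # y" "a # y \<in> ones P" using k(3)[OF xP] xP by blast
          have eq: "map (\<lambda>i. G i (x ! i)) [0..<Suc d] = (if a = 0 then h else h') # e y"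
            by (simp add: x(1) G_def e_def upt_conv_Cons map_Suc_upt[symmetric] comp_def del: upt_Suc)
          show ?thesis
          proof (cases "a = 0")
            case True
            have "y \<in> ones (project P)" using x(2) by (force simp: project_def)
            then show ?thesis using F(3) True unfolding eq by (simp add: e_def L_def)
          next
            case False
            then show ?thesis unfolding eq using h'(3) x(2) by simp
          qed
        qed
        then show "length (dims A) = length (dims P) \<and> (\<exists>F. (\<forall>i<length (dims P). strict_mono_on {..<dims P ! i} (F i) \<and>
          (\<forall>k<dims P ! i. F i k < dims A ! i)) \<and> (\<forall>x\<in>ones P. map (\<lambda>i. F i (x ! i)) [0..<length (dims P)] \<in> ones A))"
          using G k(1,2) dA by (intro conjI exI[of _ G]) (simp_all del: upt_Suc)
      qed
      then show False using av by blast
    qed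
    ultimately have "M \<in> free_matrices n (project P) d" by (simp add: free_matrices_def avoids_def M_def)
    from ex_lower[OF this] show ?thesis by (simp add: M_def)
  qed
  have finA: "finite (ones A)" using oA finite_positions finite_subset by blast
  define T where "T = {z \<in> ones A. \<forall>h'. hd z < h' \<longrightarrow> h' # tl z \<notin> ones A}"
  have A_cons: "z = hd z # tl z" "hd z < n" "tl z \<in> positions (replicate d n)" if "z \<in> ones A" for z
    using oA that by (auto simp: positions_Cons)
  have "inj_on tl T"
  proof (rule inj_onI)
    fix z w assume zw: "z \<in> T" "w \<in> T" "tl z = tl w"
    then have "z \<in> ones A" "w \<in> ones A" by (auto simp: T_def)
    note c = A_cons(1)[OF this(1)] A_cons(1)[OF this(2)]
    have "\<not> hd z < hd w" "\<not> hd w < hd z" using zw c unfolding T_def by (metis (mono_tags, lifting) mem_Collect_eq)+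
    then have "hd z = hd w" by simp
    then show "z = w" using c zw(3) by metis
  qed
  moreover have "tl ` T \<subseteq> positions (replicate d n)" using A_cons(3) by (auto simp: T_def)
  ultimately have "card T \<le> card (positions (replicate d n))" using finite_positions by (rule card_inj_on_le)
  also have "card (positions (replicate d n)) = n ^ d"
  proof (induction d)
    case (Suc d)
    have "card (positions (replicate (Suc d) n)) = card ({..<n} \<times> positions (replicate d n))"
      unfolding replicate_Suc positions_Cons by (rule card_image) (auto simp: inj_on_def)
    then show ?case using Suc by (simp add: card_cartesian_product)
  qed simp
  finally have 1: "card T \<le> n ^ d" .
  have finL: "finite (L h)" for h
  proof -
    have "L h \<subseteq> tl ` ones A" by (force simp: L_def)
    then show ?thesis using finA finite_subset by blast
  qed
  \<comment> \<open>The last layer contributes nothing: each of its ones is the last of its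
    line.\<close>
  have "ones A - T \<subseteq> (\<Union>h<n - 1. (\<lambda>x. h # x) ` L h)"
  proof
    fix z assume z: "z \<in> ones A - T"
    then obtain h' where h': "hd z < h'" "h' # tl z \<in> ones A" by (auto simp: T_def)
    have "h' < n" using h'(2) oA by auto
    then have "hd z < n - 1" using h'(1) by simp
    moreover have "tl z \<in> L (hd z)" using z h' A_cons(1)[of z] by (auto simp: L_def)
    moreover have "z = hd z # tl z" using z A_cons(1) by blast
    ultimately show "z \<in> (\<Union>h<n - 1. (\<lambda>x. h # x) ` L h)" by blast
  qed
  then have "card (ones A - T) \<le> card (\<Union>h<n - 1. (\<lambda>x. h # x) ` L h)" using finL by (intro card_mono) auto
  also have "\<dots> \<le> (\<Sum>h<n - 1. card ((\<lambda>x. h # x) ` L h))" by (rule card_UN_le) simp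
  also have "\<dots> \<le> (\<Sum>h<n - 1. ex n (project P) d)"
  proof (rule sum_mono)
    fix h assume "h \<in> {..<n - 1}"
    then have "card (L h) \<le> ex n (project P) d" by (intro L) auto
    then show "card ((\<lambda>x. h # x) ` L h) \<le> ex n (project P) d" using card_image_le[OF finL] le_trans by blast
  qed
  also have "\<dots> \<le> n * ex n (project P) d" by simp
  finally have 2: "card (ones A - T) \<le> n * ex n (project P) d" .
  have "card (ones A) = card (ones A - T) + card T"
    using finA card_mono[of "ones A" T] by (simp add: card_Diff_subset T_def)
  then show "card (ones A) \<le> n ^ d + n * ex n (project P) d" using 1 2 by linarith
qed

text \<open>For \<open>P'\<close> properly contained in \<open>raise e P\<close> the matrix
  \<open>project P'\<close> is contained in \<open>P\<close>. It differs from \<open>P\<close>,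
  since otherwise all index maps are identities and \<open>P'\<close> is \<open>raise e P\<close>
  itself. So minimality of \<open>P\<close> bounds \<open>ex\<close> of the projection, and
  \<open>ex_project_le\<close> turns this into a bound with one more factor
  \<open>n\<close>.\<close>

lemma minimally_non_O_raise:
  assumes P: "minimally_non_O d P" and d: "1 \<le> d" and e: "e \<in> ones P" and c: "1 < card (ones P)"
  shows "minimally_non_O (Suc d) (raise e P)"
  unfolding minimally_non_O_def
proof (intro conjI allI impI)
  have mP: "is_matrix01 d P" using P by (simp add: minimally_non_O_def)
  have mono: "real n ^ (Suc d - 1) = real n * real n ^ (d - 1)" for n using d by (cases d) simp_all
  show mR: "is_matrix01 (Suc d) (raise e P)" using mP e by (auto simp: is_matrix01_def raise_def)
  show "(\<lambda>n. real (ex n (raise e P) (Suc d))) \<in> \<omega>(\<lambda>n. real n ^ (Suc d - 1))"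
  proof (rule landau_omega.smallI)
    fix b :: real assume "b > 0"
    have "(\<lambda>n. real (ex n P d)) \<in> \<omega>(\<lambda>n. real n ^ (d - 1))" using P by (simp add: minimally_non_O_def)
    from landau_omega.smallD[OF this \<open>b > 0\<close>]
    show "\<forall>\<^sub>F n in at_top. b * norm (real n ^ (Suc d - 1)) \<le> norm (real (ex n (raise e P) (Suc d)))"
    proof eventually_elim
      case (elim n)
      have "b * real n ^ (Suc d - 1) = real n * (b * real n ^ (d - 1))" by (simp only: mono) simp
      also have "\<dots> \<le> real n * real (ex n P d)" using elim by (intro mult_left_mono) auto
      also have "\<dots> \<le> real (ex n (raise e P) (Suc d))"
        using ex_raise_ge[OF mP e, of n] by (metis of_nat_le_iff of_nat_mult)
      finally show ?case by simp
    qed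
  qed
  fix P' assume "is_matrix01 (Suc d) P' \<and> properly_contained P' (raise e P)"
  then have mP': "is_matrix01 (Suc d) P'" and con: "contains (raise e P) P'" and ne: "P' \<noteq> raise e P"
    by (auto simp: properly_contained_def)
  obtain k ks where k: "dims P' = k # ks" "length ks = d" "0 < k"
    "\<And>x. x \<in> ones P' \<Longrightarrow> \<exists>a y. x = a # y \<and> a < k \<and> y \<in> positions ks"
    using mP' by (rule is_matrix01_Suc) blast
  have pos: "ones P' \<subseteq> positions (dims P')" using mP' by (simp add: is_matrix01_def)
  have lenP: "length (dims P) = d" using mP by (simp add: is_matrix01_def)
  obtain F where F: "\<And>i. i < Suc d \<Longrightarrow> strict_mono_on {..<dims P' ! i} (F i)"
      "\<And>i j. i < Suc d \<Longrightarrow> j < dims P' ! i \<Longrightarrow> F i j < dims (raise e P) ! i"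
      "\<And>x. x \<in> ones P' \<Longrightarrow> map (\<lambda>i. F i (x ! i)) [0..<Suc d] \<in> ones (raise e P)"
    using con unfolding contains_iff[OF pos] by (auto simp: k(1,2) simp del: upt_Suc)
  define \<phi> where "\<phi> x = map (\<lambda>i. F (Suc i) (x ! i)) [0..<d]" for x
  have F0: "strict_mono_on {..<k} (F 0)" "\<And>j. j < k \<Longrightarrow> F 0 j < 2"
    using F(1,2)[of 0] by (simp_all add: k(1) raise_def)
  have FS: "strict_mono_on {..<ks ! i} (F (Suc i))" "\<And>j. j < ks ! i \<Longrightarrow> F (Suc i) j < dims P ! i" if "i < d" for i
    using F(1,2)[of "Suc i"] that by (simp_all add: k(1) raise_def)
  have img: "F 0 a # \<phi> x \<in> ones (raise e P)" if "a # x \<in> ones P'" for a x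
    using F(3)[OF that] by (simp add: \<phi>_def upt_conv_Cons map_Suc_upt[symmetric] comp_def del: upt_Suc)
  have raise_ones: "b # y \<in> ones (raise e P) \<longleftrightarrow> y \<in> ones P \<and> b = (if y = e then 1 else 0)" for b y
    using e by (auto simp: raise_def)
  have len_tl: "length x = d" "a < k" "\<And>i. i < d \<Longrightarrow> x ! i < ks ! i" if "a # x \<in> ones P'" for a x
    using k(4)[OF that] k(2) by (auto simp: in_positions_iff)
  have k_le: "k \<le> 2"
  proof (rule ccontr)
    assume "\<not> k \<le> 2"
    then have "2 \<le> F 0 2" using F0(1) by (intro strict_mono_on_lessThan_ge) auto
    then show False using F0(2)[of 2] \<open>\<not> k \<le> 2\<close> by simp
  qed
  \<comment> \<open>For \<open>a > 0\<close> layer \<open>a\<close> of \<open>P'\<close> is mapped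
    above the image of layer 0, hence to the layer whose only one is that over
    \<open>e\<close>.\<close>
  have top: "x = y" if "a # x \<in> ones P'" "b # y \<in> ones P'" "0 < a" "0 < b" for a b x y
  proof -
    have "F 0 0 < F 0 a" "F 0 0 < F 0 b"
      using F0(1) that len_tl(2) k(3) by (auto simp: strict_mono_on_def)
    then have "\<phi> x = e" "\<phi> y = e" using img[OF that(1)] img[OF that(2)] by (auto simp: raise_ones split: if_splits)
    then have "\<phi> x = \<phi> y" by simp
    then have eq: "F (Suc i) (x ! i) = F (Suc i) (y ! i)" if "i < d" for i
      using that by (auto simp: \<phi>_def)
    show ?thesis
    proof (rule nth_equalityI)
      show "length x = length y" using len_tl(1) that by metis
      fix i assume "i < length x"
      then have "i < d" using len_tl(1) that by metis
      then show "x ! i = y ! i"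
        using inj_onD[OF strict_mono_on_imp_inj_on[OF FS(1)] eq] len_tl(3) that by simp
    qed
  qed
  have mp: "is_matrix01 d (project P')" by (rule is_matrix01_project[OF mP'])
  have dp: "dims (project P') = ks" "ones (project P') = tl ` ones P'" by (simp_all add: project_def k(1))
  have pp: "ones (project P') \<subseteq> positions (dims (project P'))" using mp by (simp add: is_matrix01_def)
  have "contains P (project P')"
    unfolding contains_iff[OF pp] dp k(2)
  proof (intro conjI exI[of _ "\<lambda>i. F (Suc i)"] allI impI ballI)
    fix x assume "x \<in> tl ` ones P'"
    then obtain a where "a # x \<in> ones P'" using k(4) by fastforce
    from img[OF this] show "map (\<lambda>i. F (Suc i) (x ! i)) [0..<d] \<in> ones P" by (simp add: raise_ones \<phi>_def)
  qed (use FS lenP in auto)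
  moreover have "project P' \<noteq> P"
  proof
    assume eq: "project P' = P"
    then have ks: "ks = dims P" and ons: "tl ` ones P' = ones P" using dp by simp_all
    have id: "\<phi> x = x" if "a # x \<in> ones P'" for a x
      using len_tl[OF that] strict_mono_on_lessThan_id[OF FS(1)] FS(2) ks
      by (intro nth_equalityI) (auto simp: \<phi>_def)
    have lift: "\<exists>a<k. a # x \<in> ones P' \<and> F 0 a = (if x = e then 1 else 0)" if xP: "x \<in> ones P" for x
    proof -
      from xP obtain z where z: "z \<in> ones P'" "x = tl z" unfolding ons[symmetric] by blast
      then obtain a where a: "a # x \<in> ones P'" using k(4)[OF z(1)] by auto
      then show ?thesis using img[OF a] id[OF a] len_tl(2)[OF a] by (auto simp: raise_ones)
    qed
    \<comment> \<open>Here a second one is needed: \<open>e\<close> and \<open>e'\<close> come from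
      different layers of \<open>P'\<close>, so \<open>P'\<close> has both layers.\<close>
    obtain e' where e': "e' \<in> ones P" "e' \<noteq> e"
    proof (rule ccontr)
      assume "\<not> thesis"
      then have "ones P \<subseteq> {e}" using that by blast
      then have "card (ones P) \<le> 1" using card_mono[of "{e}" "ones P"] by simp
      then show False using c by simp
    qed
    have "k \<noteq> 1"
    proof
      assume "k = 1"
      then show False using lift[OF e] lift[OF e'(1)] e'(2) by auto
    qed
    then have k2: "k = 2" using k_le k(3) by simp
    have F0_id: "F 0 a = a" if "a < 2" for a using strict_mono_on_lessThan_id[of 2 "F 0" a] F0 k2 that by simp
    have "ones P' = ones (raise e P)"
    proof (intro set_eqI iffI)
      fix z assume z: "z \<in> ones P'"
      then obtain a x where ax: "z = a # x" using k(4) by blast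
      then show "z \<in> ones (raise e P)" using img[of a x] id[of a x] len_tl(2)[of a x] F0_id[of a] z k2 by simp
    next
      fix z assume z: "z \<in> ones (raise e P)"
      then obtain b x where bx: "z = b # x" by (auto simp: raise_def)
      then have x: "x \<in> ones P" "b = (if x = e then 1 else 0)" using z raise_ones by simp_all
      from lift[OF x(1)] obtain a where "a < k" "a # x \<in> ones P'" "F 0 a = b" using x(2) by auto
      then show "z \<in> ones P'" using F0_id[of a] k2 bx by simp
    qed
    moreover have "dims P' = dims (raise e P)" using k(1) k2 ks by (simp add: raise_def)
    ultimately show False using ne by (metis matrix01.expand)
  qed
  ultimately have "(\<lambda>n. real (ex n (project P') d)) \<in> O(\<lambda>n. real n ^ (d - 1))"
    using P mp by (simp add: minimally_non_O_def properly_contained_def)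
  then obtain b where b: "\<forall>\<^sub>F n in at_top. norm (real (ex n (project P') d)) \<le> b * norm (real n ^ (d - 1))"
    by (elim landau_o.bigE)
  have hd2: "hd (dims P') \<le> 2" using k(1) k_le by simp
  show "(\<lambda>n. real (ex n P' (Suc d))) \<in> O(\<lambda>n. real n ^ (Suc d - 1))"
  proof (rule bigoI)
    from b show "\<forall>\<^sub>F n in at_top. norm (real (ex n P' (Suc d))) \<le> (1 + b) * norm (real n ^ (Suc d - 1))"
    proof eventually_elim
      case (elim n)
      have "real (ex n P' (Suc d)) \<le> real (n ^ d + n * ex n (project P') d)"
        using ex_project_le[where n = n, OF mP' hd2 top] by (simp only: of_nat_le_iff)
      also have "\<dots> = real n ^ d + real n * real (ex n (project P') d)" by simp
      also have "\<dots> \<le> real n ^ d + real n * (b * real n ^ (d - 1))"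
        using elim by (intro add_left_mono mult_left_mono) auto
      also have "\<dots> = (1 + b) * real n ^ d" using mono[of n] by (simp add: algebra_simps)
      finally show ?case by simp
    qed
  qed
qed

text \<open>Since \<open>project\<close> undoes \<open>raise\<close> for any choice of the raised
  one, the map \<open>r\<close> is injective and carries an infinite set of minimal matrices to the
  next dimension.\<close>

lemma infinite_minimally_non_O:
  assumes "2 \<le> d"
  shows "infinite {P. minimally_non_O d P \<and> (\<forall>k\<in>set (dims P). k > 1) \<and> 1 < card (ones P)}"
  using assms
proof (induction d rule: dec_induct)
  case base
  show ?case by (rule infinite_minimally_non_O_2)
next
  case (step d)
  let ?A = "\<lambda>d. {P. minimally_non_O d P \<and> (\<forall>k\<in>set (dims P). k > 1) \<and> 1 < card (ones P)}"
  define r where "r P = raise (SOME e. e \<in> ones P) P" for P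
  have some: "(SOME e. e \<in> ones P) \<in> ones P" if "P \<in> ?A d" for P
  proof -
    have "ones P \<noteq> {}" using that by auto
    then show ?thesis by (simp add: some_in_eq)
  qed
  have proj: "project (r P) = P" if "P \<in> ?A d" for P
  proof -
    have "tl ` ones (r P) = ones P" using some[OF that] by (force simp: r_def raise_def image_image image_insert)
    then show ?thesis by (cases P) (simp add: project_def r_def raise_def)
  qed
  then have "inj_on r (?A d)" by (metis (no_types, lifting) inj_onI)
  moreover have "r P \<in> ?A (Suc d)" if PA: "P \<in> ?A d" for P
  proof -
    have "minimally_non_O (Suc d) (r P)"
      unfolding r_def using PA step.hyps(1) some[OF PA] by (intro minimally_non_O_raise) auto
    moreover have "\<forall>k\<in>set (dims (r P)). k > 1" using PA by (simp add: r_def raise_def)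
    moreover have "1 < card (ones (r P))"
    proof -
      have "tl ` ones (r P) = ones P" using arg_cong[OF proj[OF PA], of ones] by (simp add: project_def)
      moreover have "card (ones P) > 1" using PA by simp
      moreover from this have "finite (ones P)" using card_ge_0_finite[of "ones P"] by simp
      then have "finite (ones (r P))" by (simp add: r_def raise_def)
      ultimately show ?thesis using card_image_le[of "ones (r P)" tl] by simp
    qed
    ultimately show ?thesis by blast
  qed
  then have "r ` ?A d \<subseteq> ?A (Suc d)" by blast
  ultimately show ?case using step.IH infinite_super[of "r ` ?A d" "?A (Suc d)"] finite_imageD by blast
qed

theorem corollary3p7:
  fixes d :: nat
  assumes "d \<ge> 2"
  shows "infinite {P. minimally_non_O d P \<and> (\<forall>k\<in>set (dims P). k > 1)}"
proof -
  have "{P. minimally_non_O d P \<and> (\<forall>k\<in>set (dims P). k > 1) \<and> 1 < card (ones P)}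
    \<subseteq> {P. minimally_non_O d P \<and> (\<forall>k\<in>set (dims P). k > 1)}" by blast
  then show ?thesis using infinite_minimally_non_O[OF assms] by (rule infinite_super)
qed

end
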